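(* Suppose that $\int_{[0,1]} |\log(1-p)|\,\Lambda(dp)<\infty$ and that $\Lambda$ is log-nonlattice. Then the sequence $(L_n)_{n\ge1}$ converges in distribution.
   Context: Let $\Lambda$ be a nonzero finite measure on $[0,1]$. For $n\ge 1$, the $\Lambda$-coalescent started with $n$ blocks, $(\Pi_n(t))_{t\ge0}$, is the continuous-time Markov chain on partitions of $\{1,\dots,n\}$, started from the partition into singletons, in which, whenever there are $b$ blocks, each particular collection of $k\ge2$ blocks merges into a single block at rate $\lambda_{b,k}=\int_{[0,1]}p^{k-2}(1-p)^{b-k}\,\Lambda(dp)$, and no other transitions occur. Let $N_n(t)$ be the number of blocks of $\Pi_n(t)$, $T_n=\inf\{t\ge0:N_n(t)=1\}$, and $L_n=N_n(T_n-)$. The measure $\Lambda$ is called log-nonlattice if for every $d>0$, $\sum_{z=1}^\infty \Lambda(\{1-e^{-zd}\})<\Lambda((0,1])$. *)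

theory Defs
  imports "HOL-Probability.Probability"
begin

text \<open>Merger rate: each particular collection of k blocks out of b merges at rate
  lambda_{b,k} = integral of p^(k-2) (1-p)^(b-k) with respect to Lambda.\<close>
definition lam_rate :: "real measure \<Rightarrow> nat \<Rightarrow> nat \<Rightarrow> real" where
  "lam_rate \<Lambda> b k = (\<integral>p. p ^ (k - 2) * (1 - p) ^ (b - k) \<partial>\<Lambda>)"

definition total_rate :: "real measure \<Rightarrow> nat \<Rightarrow> real" where
  "total_rate \<Lambda> b = (\<Sum>k=2..b. real (b choose k) * lam_rate \<Lambda> b k)"

definition merge_blocks :: "nat set set \<Rightarrow> nat set set \<Rightarrow> nat set set" where
  "merge_blocks \<pi> A = (\<pi> - A) \<union> {\<Union>A}"

text \<open>Embedded jump chain of the Lambda-coalescent on partitions: from partition pi with b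
  blocks, the particular collection A of k >= 2 blocks merges with probability
  lambda_{b,k} / (total rate).\<close>
definition coal_step :: "real measure \<Rightarrow> nat set set \<Rightarrow> nat set set pmf" where
  "coal_step \<Lambda> \<pi> = embed_pmf (\<lambda>\<pi>'.
     (\<Sum>A\<in>{A. A \<subseteq> \<pi> \<and> 2 \<le> card A \<and> merge_blocks \<pi> A = \<pi>'}.
        lam_rate \<Lambda> (card \<pi>) (card A) / total_rate \<Lambda> (card \<pi>)))"

text \<open>Law of the number of blocks just before absorption (coalescence into one block),
  starting from partition pi, run for at most m jumps (m = n jumps suffice for a partition
  with n blocks since each jump decreases the number of blocks).\<close>
primrec last_blocks :: "real measure \<Rightarrow> nat \<Rightarrow> nat set set \<Rightarrow> nat pmf" where
  "last_blocks \<Lambda> 0 \<pi> = return_pmf 0"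
| "last_blocks \<Lambda> (Suc m) \<pi> =
     (if card \<pi> \<le> 1 then return_pmf 1
      else bind_pmf (coal_step \<Lambda> \<pi>)
             (\<lambda>\<pi>'. if card \<pi>' = 1 then return_pmf (card \<pi>) else last_blocks \<Lambda> m \<pi>'))"

definition singletons :: "nat \<Rightarrow> nat set set" where
  "singletons n = (\<lambda>i. {i}) ` {1..n}"

text \<open>Law of L_n = N_n(T_n -) (for n = 1, where T_1 = 0, we use the convention L_1 = 1).\<close>
definition L_law :: "real measure \<Rightarrow> nat \<Rightarrow> nat pmf" where
  "L_law \<Lambda> n = last_blocks \<Lambda> n (singletons n)"

definition log_nonlattice :: "real measure \<Rightarrow> bool" where
  "log_nonlattice \<Lambda> \<longleftrightarrow> (\<forall>d>0.
     (\<Sum>z. emeasure \<Lambda> {1 - exp (- (real (Suc z) * d))}) < emeasure \<Lambda> {0<..1})"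

end

theory Submission
  imports Defs
begin

text \<open>
  The number of blocks minus one is a decreasing chain on the natural numbers; \<open>merge_density x i p\<close>
  is the intensity of its jumps from \<open>x\<close> to \<open>i\<close> caused by a merger with parameter \<open>p\<close>. As functions of
  the starting point, the probabilities of \<open>L = j\<close> are bounded and harmonic from some point on, and
  every such function \<open>u\<close> converges, for the following reasons. Coupling the chains started with \<open>n\<close> and
  \<open>n + 1\<close> blocks shows that \<open>u\<close> is Lipschitz in \<open>log n\<close>. If \<open>u n\<close> is close to the limit superior \<open>a\<close> of
  \<open>u\<close>, then so is \<open>u\<close> near \<open>(1 - p) * n\<close> for every \<open>p\<close> in the support of the measure; since the values
  \<open>- ln (1 - p)\<close> do not lie in a lattice, the semigroup they generate is asymptotically dense, and \<open>u\<close> is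
  close to \<open>a\<close> on arbitrarily long logarithmic windows. Finally the integrability of \<open>ln (1 - p)\<close> bounds,
  uniformly in the starting point, the probability of jumping over a long window, so \<open>u\<close> is close to \<open>a\<close>
  everywhere above the window. The same bound makes the sequence of laws tight.
\<close>

section \<open>Merger intensities at a fixed p\<close>

definition merge_density :: "nat \<Rightarrow> nat \<Rightarrow> real \<Rightarrow> real" where
  "merge_density x i p = real (Suc x choose i) * (p ^ (x - 1 - i) * (1 - p) ^ i)"

lemma merge_density_nonneg: "0 \<le> p \<Longrightarrow> p \<le> 1 \<Longrightarrow> 0 \<le> merge_density x i p"
  by (simp add: merge_density_def)

lemma binomial_absorb_comp_real:
  "i \<le> n \<Longrightarrow> (real n - real i) * real (n choose i) = real n * real ((n - 1) choose i)"
  using arg_cong[OF binomial_absorb_comp[of n i], of real] by (simp add: of_nat_diff)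

lemma merge_density_eq_partial:
  assumes "i < x"
  shows "merge_density x i p * (real x + 1 - real i)
     = (real x + 1) * (real (x choose i) * (p ^ (x - 1 - i) * (1 - p) ^ i))"
proof -
  have "(real x + 1 - real i) * real (Suc x choose i) = (real x + 1) * real (x choose i)"
    using binomial_absorb_comp_real[of i "Suc x"] assms by (simp add: algebra_simps)
  then show ?thesis
    unfolding merge_density_def by (simp add: mult_ac)
qed

lemma merge_density_eq_Bernstein:
  assumes "i < x"
  shows "merge_density x i p * ((real x + 1 - real i) * (real x - real i))
     = (real x + 1) * real x * Bernstein (x - 1) i (1 - p)"
proof -
  have *: "(real x - real i) * real (x choose i) = real x * real ((x - 1) choose i)"
    using binomial_absorb_comp_real[of i x] assms by simp
  have "merge_density x i p * ((real x + 1 - real i) * (real x - real i))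
      = (real x + 1) * (((real x - real i) * real (x choose i)) * (p ^ (x - 1 - i) * (1 - p) ^ i))"
    using merge_density_eq_partial[OF assms, of p] by (simp add: mult_ac)
  also have "\<dots> = (real x + 1) * real x * Bernstein (x - 1) i (1 - p)"
    unfolding * by (simp add: Bernstein_def mult_ac)
  finally show ?thesis .
qed

lemma Bernstein_le_merge_density:
  assumes "i < x" "0 \<le> p" "p \<le> 1"
  shows "Bernstein (x - 1) i (1 - p) \<le> merge_density x i p"
proof -
  let ?c = "(real x + 1 - real i) * (real x - real i)"
  have c: "0 < ?c" "?c \<le> (real x + 1) * real x"
    using assms by (auto intro!: mult_mono mult_pos_pos)
  have B: "0 \<le> Bernstein (x - 1) i (1 - p)"
    using assms by (intro Bernstein_nonneg) auto
  have "Bernstein (x - 1) i (1 - p) * ?c \<le> merge_density x i p * ?c"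
    unfolding merge_density_eq_Bernstein[OF assms(1)]
    using mult_left_mono[OF c(2) B] by (simp add: mult_ac)
  then show ?thesis using c(1) by (rule mult_right_le_imp_le)
qed

lemma merge_density_le_Bernstein:
  assumes "i < x" "0 \<le> p" "p \<le> 1" "0 < \<eta>" "\<eta> * real x \<le> real x - real i"
  shows "merge_density x i p \<le> Bernstein (x - 1) i (1 - p) / \<eta>\<^sup>2"
proof -
  let ?c = "(real x + 1 - real i) * (real x - real i)"
  have \<eta>: "\<eta> \<le> 1"
  proof (rule ccontr)
    assume "\<not> \<eta> \<le> 1"
    then have "1 * real x < \<eta> * real x" using assms by (intro mult_strict_right_mono) auto
    then show False using assms(5) of_nat_0_le_iff[of i, where 'a=real] by linarith
  qed
  have c: "0 < ?c" using assms by auto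
  have B: "0 \<le> Bernstein (x - 1) i (1 - p)"
    using assms by (intro Bernstein_nonneg) auto
  have 1: "\<eta> * (real x + 1) \<le> real x + 1 - real i" using assms \<eta> by (simp add: algebra_simps)
  have "(\<eta> * (real x + 1)) * (\<eta> * real x) \<le> ?c"
    using assms 1 by (intro mult_mono) auto
  then have "\<eta>\<^sup>2 * ((real x + 1) * real x) \<le> ?c" by (simp add: power2_eq_square mult_ac)
  then have "(\<eta>\<^sup>2 * ((real x + 1) * real x)) * Bernstein (x - 1) i (1 - p)
     \<le> ?c * Bernstein (x - 1) i (1 - p)" using B by (rule mult_right_mono)
  moreover have "(\<eta>\<^sup>2 * merge_density x i p) * ?c
      = (\<eta>\<^sup>2 * ((real x + 1) * real x)) * Bernstein (x - 1) i (1 - p)"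
    using arg_cong[OF merge_density_eq_Bernstein[OF assms(1), of p], of "\<lambda>z. \<eta>\<^sup>2 * z"]
    by (simp only: mult_ac)
  ultimately have "(\<eta>\<^sup>2 * merge_density x i p) * ?c \<le> Bernstein (x - 1) i (1 - p) * ?c"
    by (simp only: mult.commute)
  then have "\<eta>\<^sup>2 * merge_density x i p \<le> Bernstein (x - 1) i (1 - p)"
    using c by (rule mult_right_le_imp_le)
  then show ?thesis using assms by (simp add: field_simps)
qed

lemma sum_Bernstein_lessThan: "0 < x \<Longrightarrow> (\<Sum>i<x. Bernstein (x - 1) i q) = 1"
  using sum_Bernstein[of "x - 1" q] by (cases x) (simp_all add: lessThan_Suc_atMost)

lemma sum_merge_density_far_le:
  assumes "0 < x" "0 \<le> p" "p \<le> 1" "0 < \<eta>" "I \<subseteq> {..<x}" "\<And>i. i \<in> I \<Longrightarrow> \<eta> * real x \<le> real x - real i"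
  shows "(\<Sum>i\<in>I. merge_density x i p) \<le> 1 / \<eta>\<^sup>2"
proof -
  have "(\<Sum>i\<in>I. merge_density x i p) \<le> (\<Sum>i\<in>I. Bernstein (x - 1) i (1 - p) / \<eta>\<^sup>2)"
    using assms by (intro sum_mono merge_density_le_Bernstein) auto
  also have "\<dots> \<le> (\<Sum>i<x. Bernstein (x - 1) i (1 - p) / \<eta>\<^sup>2)"
    using assms by (intro sum_mono2 divide_nonneg_nonneg Bernstein_nonneg) auto
  also have "\<dots> = 1 / \<eta>\<^sup>2"
    using sum_Bernstein_lessThan[OF assms(1)] by (simp flip: sum_divide_distrib)
  finally show ?thesis .
qed

lemma sum_merge_density_ge_1:
  assumes "0 < x" "0 \<le> p" "p \<le> 1"
  shows "1 \<le> (\<Sum>i<x. merge_density x i p)"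
proof -
  have "(\<Sum>i<x. Bernstein (x - 1) i (1 - p)) \<le> (\<Sum>i<x. merge_density x i p)"
    using assms by (intro sum_mono Bernstein_le_merge_density) auto
  then show ?thesis using sum_Bernstein_lessThan[OF assms(1)] by simp
qed

lemma sum_binomial_eq_geometric:
  fixes p :: real
  shows "(\<Sum>i<x. real (x choose i) * (p ^ (x - 1 - i) * (1 - p) ^ i)) = (\<Sum>l<x. (1 - p) ^ l)"
proof (cases "p = 0")
  case True
  have "(\<Sum>i<x. real (x choose i) * (p ^ (x - 1 - i) * (1 - p) ^ i))
      = (\<Sum>i<x. if i = x - 1 then real x else 0)"
  proof (intro sum.cong refl)
    fix i assume "i \<in> {..<x}"
    then show "real (x choose i) * (p ^ (x - 1 - i) * (1 - p) ^ i) = (if i = x - 1 then real x else 0)"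
      using True by (cases x) (auto simp: Suc_diff_Suc)
  qed
  also have "\<dots> = real x" by (cases x) auto
  finally show ?thesis using True by simp
next
  case False
  have "1 = ((1 - p) + p) ^ x" by simp
  also have "\<dots> = (\<Sum>i\<le>x. real (x choose i) * (1 - p) ^ i * p ^ (x - i))" by (rule binomial_ring)
  also have "\<dots> = (\<Sum>i<x. real (x choose i) * (1 - p) ^ i * p ^ (x - i)) + (1 - p) ^ x"
    by (simp flip: lessThan_Suc_atMost)
  also have "(\<Sum>i<x. real (x choose i) * (1 - p) ^ i * p ^ (x - i))
      = p * (\<Sum>i<x. real (x choose i) * (p ^ (x - 1 - i) * (1 - p) ^ i))"
    unfolding sum_distrib_left
  proof (intro sum.cong refl)
    fix i assume "i \<in> {..<x}"
    then have "x - i = Suc (x - 1 - i)" by auto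
    then show "real (x choose i) * (1 - p) ^ i * p ^ (x - i)
        = p * (real (x choose i) * (p ^ (x - 1 - i) * (1 - p) ^ i))"
      by simp
  qed
  finally have "p * (\<Sum>i<x. real (x choose i) * (p ^ (x - 1 - i) * (1 - p) ^ i)) = 1 - (1 - p) ^ x"
    by simp
  also have "\<dots> = p * (\<Sum>l<x. (1 - p) ^ l)"
    using one_diff_power_eq[of "1 - p" x] by simp
  finally show ?thesis using False by simp
qed

lemma merge_density_drift_ge:
  assumes "0 \<le> p" "p \<le> 1"
  shows "(real x + 1) / 2 * (\<Sum>l<x. (1 - p) ^ l) \<le> (\<Sum>i<x. merge_density x i p * (real x - real i))"
  unfolding sum_binomial_eq_geometric[symmetric] sum_distrib_left
proof (intro sum_mono)
  fix i assume "i \<in> {..<x}"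
  then have i: "i < x" by simp
  have "(real x + 1) / 2 * (real (x choose i) * (p ^ (x - 1 - i) * (1 - p) ^ i))
      = merge_density x i p * ((real x + 1 - real i) / 2)"
    using merge_density_eq_partial[OF i, of p] by simp
  also have "\<dots> \<le> merge_density x i p * (real x - real i)"
    using i by (intro mult_left_mono merge_density_nonneg assms) auto
  finally show "(real x + 1) / 2 * (real (x choose i) * (p ^ (x - 1 - i) * (1 - p) ^ i))
     \<le> merge_density x i p * (real x - real i)" .
qed

lemma sum_binomial_div_Suc_le:
  fixes q :: real
  assumes "0 < q" "q \<le> 1"
  shows "(\<Sum>i\<le>n. real (n choose i) * q ^ i * (1 - q) ^ (n - i) / (real i + 1)) \<le> 1 / ((real n + 1) * q)"
proof -
  have "(real n + 1) * q * (\<Sum>i\<le>n. real (n choose i) * q ^ i * (1 - q) ^ (n - i) / (real i + 1))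
      = (\<Sum>i\<le>n. real (Suc n choose Suc i) * q ^ Suc i * (1 - q) ^ (Suc n - Suc i))"
    unfolding sum_distrib_left
  proof (intro sum.cong refl)
    fix i
    have "(real i + 1) * real (Suc n choose Suc i) = (real n + 1) * real (n choose i)"
      using Suc_times_binomial[of i n] by (metis of_nat_Suc of_nat_mult add.commute)
    then have "real (Suc n choose Suc i) = (real n + 1) * real (n choose i) / (real i + 1)"
      by (simp add: field_simps)
    then show "(real n + 1) * q * (real (n choose i) * q ^ i * (1 - q) ^ (n - i) / (real i + 1))
      = real (Suc n choose Suc i) * q ^ Suc i * (1 - q) ^ (Suc n - Suc i)"
      by simp
  qed
  also have "\<dots> \<le> (\<Sum>i\<le>Suc n. real (Suc n choose i) * q ^ i * (1 - q) ^ (Suc n - i))"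
    using assms by (subst sum.atMost_Suc_shift) simp
  also have "\<dots> = (q + (1 - q)) ^ Suc n" by (rule binomial_ring[symmetric])
  also have "\<dots> = 1" by simp
  finally show ?thesis using assms by (subst pos_le_divide_eq) (auto simp: mult_ac)
qed

lemma sum_merge_density_low_le:
  assumes "0 < x" "0 \<le> p" "p < 1" "2 * m \<le> x"
  shows "(\<Sum>i<m. merge_density x i p) \<le> 4 * min 1 (real m / (real x * (1 - p)))"
proof -
  have le: "merge_density x i p \<le> 4 * Bernstein (x - 1) i (1 - p)" if "i < m" for i
    using merge_density_le_Bernstein[of i x p "1/2"] assms that by (simp add: power2_eq_square)
  have B: "0 \<le> Bernstein (x - 1) i (1 - p)" for i
    using assms by (intro Bernstein_nonneg) auto
  have "(\<Sum>i<m. Bernstein (x - 1) i (1 - p)) \<le> (\<Sum>i<m. real m * (Bernstein (x - 1) i (1 - p) / (real i + 1)))"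
  proof (intro sum_mono)
    fix i assume "i \<in> {..<m}"
    then have "1 \<le> real m / (real i + 1)" by simp
    from mult_left_mono[OF this B] show "Bernstein (x - 1) i (1 - p) \<le> real m * (Bernstein (x - 1) i (1 - p) / (real i + 1))"
      by (simp add: mult_ac)
  qed
  also have "\<dots> \<le> (\<Sum>i\<le>x-1. real m * (Bernstein (x - 1) i (1 - p) / (real i + 1)))"
    using assms B by (intro sum_mono2) auto
  also have "\<dots> \<le> real m * (1 / (real x * (1 - p)))"
    unfolding sum_distrib_left[symmetric] Bernstein_def
    using sum_binomial_div_Suc_le[of "1 - p" "x - 1"] assms
    by (intro mult_left_mono) (auto simp: of_nat_diff)
  finally have "(\<Sum>i<m. Bernstein (x - 1) i (1 - p)) \<le> real m / (real x * (1 - p))" by simp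
  moreover have "(\<Sum>i<m. Bernstein (x - 1) i (1 - p)) \<le> (\<Sum>i<x. Bernstein (x - 1) i (1 - p))"
    using assms B by (intro sum_mono2) auto
  moreover have "(\<Sum>i<m. merge_density x i p) \<le> 4 * (\<Sum>i<m. Bernstein (x - 1) i (1 - p))"
    unfolding sum_distrib_left using le by (intro sum_mono) auto
  ultimately show ?thesis using sum_Bernstein_lessThan[OF assms(1)] by simp
qed

lemma merge_density_near_drift_le:
  assumes "0 < p" "p \<le> 1" "0 < \<eta>" "1 \<le> \<eta> * real x" "I \<subseteq> {..<x}"
    "\<And>i. i \<in> I \<Longrightarrow> real x - real i \<le> \<eta> * real x"
  shows "(\<Sum>i\<in>I. merge_density x i p * (real x - real i)) \<le> (real x + 1) * (min 1 (2 * \<eta> / p) / p)"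
proof -
  define b where "b i = real (x choose i) * p ^ (x - i) * (1 - p) ^ i" for i
  have b0: "0 \<le> b i" for i unfolding b_def using assms by auto
  have 1: "(\<Sum>i\<in>I. merge_density x i p * (real x - real i)) \<le> (\<Sum>i\<in>I. (real x + 1) * (b i / p))"
  proof (intro sum_mono)
    fix i assume "i \<in> I"
    then have i: "i < x" using assms by auto
    have e: "x - i = Suc (x - 1 - i)" using i by auto
    have "merge_density x i p * (real x - real i) \<le> merge_density x i p * (real x + 1 - real i)"
      using assms i by (intro mult_left_mono merge_density_nonneg) auto
    also have "\<dots> = (real x + 1) * (b i / p)"
      unfolding merge_density_eq_partial[OF i] b_def e using assms by simp
    finally show "merge_density x i p * (real x - real i) \<le> (real x + 1) * (b i / p)" .
  qed
  have tot: "(\<Sum>i\<le>x. b i) = 1"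
    using binomial_ring[of "1 - p" p x] by (simp add: b_def mult_ac)
  have sub: "I \<subseteq> {..x}" using assms by auto
  have "(\<Sum>i\<in>I. b i) \<le> (\<Sum>i\<le>x. b i)" using sub b0 by (intro sum_mono2) auto
  then have A: "(\<Sum>i\<in>I. b i) \<le> 1" using tot by simp
  have "(\<Sum>i\<in>I. b i) \<le> (\<Sum>i\<in>I. (\<eta> * real x + 1) * (b i / (real (x - i) + 1)))"
  proof (intro sum_mono)
    fix i assume i: "i \<in> I"
    then have "real (x - i) \<le> \<eta> * real x" using assms by (auto simp: of_nat_diff)
    then have "1 \<le> (\<eta> * real x + 1) / (real (x - i) + 1)" by (simp add: field_simps)
    from mult_left_mono[OF this b0[of i]]
    show "b i \<le> (\<eta> * real x + 1) * (b i / (real (x - i) + 1))" by (simp add: mult_ac)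
  qed
  also have "\<dots> \<le> (\<Sum>i\<le>x. (\<eta> * real x + 1) * (b i / (real (x - i) + 1)))"
    using assms sub b0 by (intro sum_mono2) auto
  also have "\<dots> = (\<eta> * real x + 1) * (\<Sum>i\<le>x. b i / (real (x - i) + 1))"
    by (simp add: sum_distrib_left)
  also have "(\<Sum>i\<le>x. b i / (real (x - i) + 1))
      = (\<Sum>k\<le>x. real (x choose k) * p ^ k * (1 - p) ^ (x - k) / (real k + 1))"
    unfolding b_def
    by (rule sum.reindex_bij_witness[of _ "\<lambda>i. x - i" "\<lambda>i. x - i"])
      (auto simp: binomial_symmetric[symmetric])
  also have "(\<eta> * real x + 1) * \<dots> \<le> (\<eta> * real x + 1) * (1 / ((real x + 1) * p))"
    using assms by (intro mult_left_mono sum_binomial_div_Suc_le) auto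
  also have "\<dots> \<le> (2 * \<eta> * (real x + 1)) * (1 / ((real x + 1) * p))"
    using assms by (intro mult_right_mono) (auto simp: algebra_simps)
  also have "\<dots> = 2 * \<eta> / p"
    using assms by (simp add: add_nonneg_eq_0_iff)
  finally have "(\<Sum>i\<in>I. b i) \<le> min 1 (2 * \<eta> / p)" using A by simp
  then have "(real x + 1) * ((\<Sum>i\<in>I. b i) / p) \<le> (real x + 1) * (min 1 (2 * \<eta> / p) / p)"
    using assms by (intro mult_left_mono divide_right_mono) auto
  then show ?thesis using 1 by (simp add: sum_distrib_left sum_divide_distrib)
qed

lemma sum_Bernstein_window_ge:
  assumes "0 \<le> q" "q \<le> 1" "0 < \<zeta>" "1 \<le> \<zeta> * real x" "1 \<le> \<zeta>\<^sup>2 * real x" "0 < x"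
  shows "1 / 2 \<le> (\<Sum>i | i < x \<and> \<bar>real i - q * real x\<bar> \<le> 3 * \<zeta> * real x. Bernstein (x - 1) i q)"
    (is "_ \<le> sum ?B ?I")
proof -
  let ?n = "x - 1"
  have n: "real ?n = real x - 1" using assms by (simp add: of_nat_diff)
  have B: "0 \<le> ?B i" for i using assms by (intro Bernstein_nonneg) auto
  have var: "(\<Sum>i\<le>?n. (real i - real ?n * q)\<^sup>2 * ?B i) = real ?n * q * (1 - q)"
  proof -
    have "(\<Sum>i\<le>?n. (real i - real ?n * q)\<^sup>2 * ?B i)
       = (\<Sum>i\<le>?n. real i * (real i - 1) * ?B i) + (1 - 2 * real ?n * q) * (\<Sum>i\<le>?n. real i * ?B i)
          + (real ?n * q)\<^sup>2 * (\<Sum>i\<le>?n. ?B i)"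
      unfolding sum_distrib_left sum.distrib[symmetric]
      by (intro sum.cong refl) (simp add: power2_eq_square algebra_simps)
    also have "\<dots> = real ?n * (real ?n - 1) * q\<^sup>2 + (1 - 2 * real ?n * q) * (real ?n * q) + (real ?n * q)\<^sup>2"
      by (simp only: sum_kk_Bernstein sum_k_Bernstein sum_Bernstein mult_1_right)
    also have "\<dots> = real ?n * q * (1 - q)" by (simp add: power2_eq_square algebra_simps)
    finally show ?thesis .
  qed
  have atM: "{..?n} = {..<x}" using assms by auto
  have out: "(\<Sum>i\<in>{..<x} - ?I. ?B i) \<le> 1 / 2"
  proof -
    have pos: "0 < (2 * \<zeta> * real x)\<^sup>2" using assms by simp
    have "(2 * \<zeta> * real x)\<^sup>2 * (\<Sum>i\<in>{..<x} - ?I. ?B i)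
       \<le> (\<Sum>i\<in>{..<x} - ?I. (real i - real ?n * q)\<^sup>2 * ?B i)"
      unfolding sum_distrib_left
    proof (intro sum_mono mult_right_mono B)
      fix i assume "i \<in> {..<x} - ?I"
      then have "3 * \<zeta> * real x < \<bar>real i - q * real x\<bar>" by auto
      then have "2 * \<zeta> * real x \<le> \<bar>real i - real ?n * q\<bar>"
        unfolding n left_diff_distrib mult_1_left mult.commute[of q] using assms by linarith
      then show "(2 * \<zeta> * real x)\<^sup>2 \<le> (real i - real ?n * q)\<^sup>2"
        using assms by (subst abs_le_square_iff[symmetric]) (simp add: abs_mult)
    qed
    also have "\<dots> \<le> (\<Sum>i\<le>?n. (real i - real ?n * q)\<^sup>2 * ?B i)"
      unfolding atM using B by (intro sum_mono2) auto
    also have "\<dots> = real ?n * (q * (1 - q))" unfolding var by simp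
    also have "\<dots> \<le> real x * 1"
      using assms by (intro mult_mono mult_le_one) auto
    also have "\<dots> \<le> real x * (2 * (\<zeta>\<^sup>2 * real x))"
      using assms by (intro mult_left_mono) auto
    also have "\<dots> = (2 * \<zeta> * real x)\<^sup>2 * (1/2)" by (simp add: power2_eq_square)
    finally show ?thesis using pos by (rule mult_left_le_imp_le)
  qed
  have "sum ?B {..<x} = sum ?B ?I + sum ?B ({..<x} - ?I)"
    using sum.subset_diff[of ?I "{..<x}" ?B] by (auto simp: add.commute)
  then show ?thesis using out sum_Bernstein_lessThan[OF assms(6), of q] by simp
qed

section \<open>Harmonic functions of the block-counting chain\<close>

lemma ln_one_plus_le_abs_ln:
  fixes p :: real
  assumes "0 \<le> p" "p < 1" "0 \<le> \<delta>" "\<delta> \<le> 1"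
  shows "ln (1 + \<delta> / (1 - p)) \<le> ln 2 + \<bar>ln (1 - p)\<bar>"
proof -
  have "1 + \<delta> / (1 - p) = (1 - p + \<delta>) / (1 - p)" using assms by (simp add: add_divide_distrib)
  also have "\<dots> \<le> 2 / (1 - p)" using assms by (intro divide_right_mono) auto
  finally have "1 + \<delta> / (1 - p) \<le> 2 / (1 - p)" .
  moreover have "0 < 1 + \<delta> / (1 - p)" using assms by (intro add_pos_nonneg) auto
  ultimately have "ln (1 + \<delta> / (1 - p)) \<le> ln (2 / (1 - p))" using assms by (subst ln_le_cancel_iff) auto
  also have "\<dots> = ln 2 - ln (1 - p)" using assms by (simp add: ln_div)
  finally show ?thesis by simp
qed

locale log_integrable_measure = finite_measure \<Lambda> for \<Lambda> :: "real measure" +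
  assumes sets_eq_borel: "sets \<Lambda> = sets borel"
    and emeasure_outside: "emeasure \<Lambda> (- {0..1}) = 0"
    and emeasure_unit_interval: "emeasure \<Lambda> {0..1} \<noteq> 0"
    and log_moment_finite: "(\<integral>\<^sup>+p. (if p = 1 then \<infinity> else ennreal \<bar>ln (1 - p)\<bar>) \<partial>\<Lambda>) < \<infinity>"
begin

definition mass :: real where "mass = measure \<Lambda> UNIV"

definition mixed_moment :: "nat \<Rightarrow> nat \<Rightarrow> real" where
  "mixed_moment a i = (\<integral>p. p ^ a * (1 - p) ^ i \<partial>\<Lambda>)"

definition jump_rate :: "nat \<Rightarrow> nat \<Rightarrow> real" where
  "jump_rate x i = (\<integral>p. merge_density x i p \<partial>\<Lambda>)"

definition harmonic_at :: "(nat \<Rightarrow> real) \<Rightarrow> nat \<Rightarrow> bool" where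
  "harmonic_at u x \<longleftrightarrow> (\<Sum>i<x. jump_rate x i * (u x - u i)) = 0"

definition log_moment :: "real \<Rightarrow> real" where
  "log_moment \<delta> = (\<integral>p. ln (1 + \<delta> / (1 - p)) \<partial>\<Lambda>)"

lemma space_UNIV [simp]: "space \<Lambda> = UNIV"
  using sets_eq_imp_space_eq[OF sets_eq_borel] by simp

lemma measurable_from_borel: "f \<in> borel_measurable borel \<Longrightarrow> f \<in> borel_measurable \<Lambda>"
  using measurable_cong_sets[OF sets_eq_borel refl] by blast

lemma AE_range: "AE p in \<Lambda>. 0 \<le> p \<and> p < 1"
proof -
  have "AE p in \<Lambda>. p \<in> {0..1}"
    using emeasure_outside sets_eq_borel by (intro AE_I[of _ _ "- {0..1}"]) auto
  moreover have "AE p in \<Lambda>. (if p = 1 then \<infinity> else ennreal \<bar>ln (1 - p)\<bar>) \<noteq> \<infinity>"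
    using log_moment_finite by (intro nn_integral_noteq_infinite measurable_from_borel) auto
  ultimately show ?thesis by eventually_elim (auto split: if_splits)
qed

lemma integrable_bounded:
  assumes "f \<in> borel_measurable borel" "\<And>p. 0 \<le> p \<Longrightarrow> p < 1 \<Longrightarrow> \<bar>f p\<bar> \<le> B"
  shows "integrable \<Lambda> (f :: real \<Rightarrow> real)"
proof (rule integrable_const_bound[of _ B])
  show "AE p in \<Lambda>. norm (f p) \<le> B" using AE_range by eventually_elim (use assms in auto)
qed (use assms measurable_from_borel in auto)

lemma integral_mono_range:
  assumes "integrable \<Lambda> f" "integrable \<Lambda> g" "\<And>p. 0 \<le> p \<Longrightarrow> p < 1 \<Longrightarrow> f p \<le> (g p :: real)"
  shows "(\<integral>p. f p \<partial>\<Lambda>) \<le> (\<integral>p. g p \<partial>\<Lambda>)"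
proof (rule integral_mono_AE[OF assms(1,2)])
  show "AE p in \<Lambda>. f p \<le> g p" using AE_range by eventually_elim (use assms in auto)
qed

lemma mass_pos: "0 < mass"
proof -
  have "emeasure \<Lambda> {0..1} \<le> emeasure \<Lambda> UNIV"
    using sets_eq_borel by (intro emeasure_mono) auto
  then show ?thesis
    using emeasure_unit_interval unfolding mass_def
    by (metis emeasure_eq_measure ennreal_0 le_zero_eq measure_nonneg order_le_less zero_less_measure_iff)
qed

lemma integrable_mixed: "integrable \<Lambda> (\<lambda>p. p ^ a * (1 - p) ^ i)"
  by (rule integrable_bounded[where B = 1])
     (auto simp: abs_mult power_abs intro!: mult_le_one power_le_one)

lemma integrable_merge_density: "integrable \<Lambda> (merge_density x i)"
  unfolding merge_density_def using integrable_mixed by (intro integrable_mult_right)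

lemma jump_rate_eq: "jump_rate x i = real (Suc x choose i) * mixed_moment (x - 1 - i) i"
  by (simp add: jump_rate_def merge_density_def mixed_moment_def)

lemma mixed_moment_nonneg: "0 \<le> mixed_moment a i"
  unfolding mixed_moment_def
proof (rule integral_nonneg_AE)
  show "AE p in \<Lambda>. 0 \<le> p ^ a * (1 - p) ^ i" using AE_range by eventually_elim auto
qed

lemma jump_rate_nonneg: "0 \<le> jump_rate x i"
  by (simp add: jump_rate_eq mixed_moment_nonneg)

lemma mixed_moment_split: "mixed_moment a i = mixed_moment (Suc a) i + mixed_moment a (Suc i)"
  unfolding mixed_moment_def Bochner_Integration.integral_add[OF integrable_mixed integrable_mixed, symmetric]
  by (intro arg_cong[where f = "integral\<^sup>L \<Lambda>"] ext) (simp add: algebra_simps)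

lemma sum_jump_rate: "finite I \<Longrightarrow> (\<Sum>i\<in>I. jump_rate x i * c i) = (\<integral>p. (\<Sum>i\<in>I. merge_density x i p * c i) \<partial>\<Lambda>)"
  unfolding jump_rate_def
  by (subst Bochner_Integration.integral_sum) (auto intro: integrable_merge_density)

lemma integrable_sum_merge_density: "integrable \<Lambda> (\<lambda>p. \<Sum>i\<in>I. merge_density x i p * c i)"
  by (intro Bochner_Integration.integrable_sum integrable_mult_left integrable_merge_density)

lemma jump_rate_drift_ge:
  "(real x + 1) / 2 * (\<Sum>l<x. mixed_moment 0 l) \<le> (\<Sum>i<x. jump_rate x i * (real x - real i))"
proof -
  have i: "integrable \<Lambda> (\<lambda>p. (1 - p) ^ l)" for l using integrable_mixed[of 0 l] by simp
  have "(real x + 1) / 2 * (\<Sum>l<x. mixed_moment 0 l) = (\<integral>p. (real x + 1) / 2 * (\<Sum>l<x. (1 - p) ^ l) \<partial>\<Lambda>)"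
    using i by (simp add: mixed_moment_def Bochner_Integration.integral_sum)
  also have "\<dots> \<le> (\<integral>p. (\<Sum>i<x. merge_density x i p * (real x - real i)) \<partial>\<Lambda>)"
    using i integrable_sum_merge_density merge_density_drift_ge
    by (intro integral_mono_range) auto
  finally show ?thesis by (simp add: sum_jump_rate)
qed

lemma jump_rate_drift_ge_mass:
  assumes "0 < x"
  shows "(real x + 1) / 2 * mass \<le> (\<Sum>i<x. jump_rate x i * (real x - real i))"
proof -
  have "mass = mixed_moment 0 0" by (simp add: mixed_moment_def mass_def)
  also have "\<dots> \<le> (\<Sum>l<x. mixed_moment 0 l)"
    using assms by (intro member_le_sum) (auto simp: mixed_moment_nonneg)
  finally have "(real x + 1) / 2 * mass \<le> (real x + 1) / 2 * (\<Sum>l<x. mixed_moment 0 l)"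
    by (intro mult_left_mono) auto
  then show ?thesis using jump_rate_drift_ge by (rule order_trans)
qed

lemma sum_jump_rate_far_le:
  assumes "0 < x" "0 < \<eta>" "I \<subseteq> {..<x}" "\<And>i. i \<in> I \<Longrightarrow> \<eta> * real x \<le> real x - real i"
  shows "(\<Sum>i\<in>I. jump_rate x i) \<le> mass / \<eta>\<^sup>2"
proof -
  have "finite I" using assms finite_subset by blast
  then have "(\<Sum>i\<in>I. jump_rate x i) = (\<integral>p. (\<Sum>i\<in>I. merge_density x i p) \<partial>\<Lambda>)"
    using sum_jump_rate[of I x "\<lambda>_. 1"] by simp
  also have "\<dots> \<le> (\<integral>p. 1 / \<eta>\<^sup>2 \<partial>\<Lambda>)"
    using integrable_sum_merge_density[of x "\<lambda>_. 1" I] assms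
    by (intro integral_mono_range sum_merge_density_far_le) auto
  finally show ?thesis by (simp add: mass_def)
qed

lemma sum_jump_rate_ge:
  assumes "0 < x"
  shows "mass \<le> (\<Sum>i<x. jump_rate x i)"
proof -
  have "mass = (\<integral>p. 1 \<partial>\<Lambda>)" by (simp add: mass_def)
  also have "\<dots> \<le> (\<integral>p. (\<Sum>i<x. merge_density x i p) \<partial>\<Lambda>)"
    using integrable_sum_merge_density[of x "\<lambda>_. 1" "{..<x}"] assms
    by (intro integral_mono_range sum_merge_density_ge_1) auto
  finally show ?thesis using sum_jump_rate[of "{..<x}" x "\<lambda>_. 1"] by simp
qed

lemma sum_jump_rate_pos: "0 < x \<Longrightarrow> 0 < (\<Sum>i<x. jump_rate x i)"
  using sum_jump_rate_ge[of x] mass_pos by simp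

lemma harmonic_at_iff: "harmonic_at u x \<longleftrightarrow> (\<Sum>i<x. jump_rate x i) * u x = (\<Sum>i<x. jump_rate x i * u i)"
  by (simp add: harmonic_at_def right_diff_distrib sum_subtractf sum_distrib_right)

lemma sum_jump_rate_low_le:
  assumes "0 < x" "2 * m \<le> x"
  shows "(\<Sum>i<m. jump_rate x i) \<le> 4 * (\<integral>p. min 1 (real m / (real x * (1 - p))) \<partial>\<Lambda>)"
proof -
  have *: "integrable \<Lambda> (\<lambda>p. min 1 (real m / (real x * (1 - p))))"
    by (rule integrable_bounded[where B = 1]) auto
  have "(\<Sum>i<m. jump_rate x i) = (\<integral>p. (\<Sum>i<m. merge_density x i p) \<partial>\<Lambda>)"
    using sum_jump_rate[of "{..<m}" x "\<lambda>_. 1"] by simp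
  also have "\<dots> \<le> (\<integral>p. 4 * min 1 (real m / (real x * (1 - p))) \<partial>\<Lambda>)"
    using integrable_sum_merge_density[of x "\<lambda>_. 1" "{..<m}"] assms *
    by (intro integral_mono_range sum_merge_density_low_le) auto
  finally show ?thesis using * by simp
qed

lemma integrable_abs_ln: "integrable \<Lambda> (\<lambda>p. \<bar>ln (1 - p)\<bar>)"
proof (rule integrableI_bounded)
  show "(\<lambda>p. \<bar>ln (1 - p)\<bar>) \<in> borel_measurable \<Lambda>" by (intro measurable_from_borel) auto
  have "(\<integral>\<^sup>+p. ennreal (norm \<bar>ln (1 - p)\<bar>) \<partial>\<Lambda>)
      \<le> (\<integral>\<^sup>+p. (if p = 1 then \<infinity> else ennreal \<bar>ln (1 - p)\<bar>) \<partial>\<Lambda>)"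
    by (intro nn_integral_mono) auto
  then show "(\<integral>\<^sup>+p. ennreal (norm \<bar>ln (1 - p)\<bar>) \<partial>\<Lambda>) < \<infinity>"
    using log_moment_finite by (rule le_less_trans)
qed

lemma integrable_ln_one_plus:
  assumes "0 \<le> \<delta>" "\<delta> \<le> 1"
  shows "integrable \<Lambda> (\<lambda>p. ln (1 + \<delta> / (1 - p)))"
proof (rule Bochner_Integration.integrable_bound)
  show "integrable \<Lambda> (\<lambda>p. ln 2 + \<bar>ln (1 - p)\<bar>)" using integrable_abs_ln by simp
  show "AE p in \<Lambda>. norm (ln (1 + \<delta> / (1 - p))) \<le> norm (ln 2 + \<bar>ln (1 - p)\<bar>)"
    using AE_range
  proof eventually_elim
    case (elim p)
    then have "0 \<le> ln (1 + \<delta> / (1 - p))" using assms by (intro ln_ge_zero) auto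
    then show ?case using ln_one_plus_le_abs_ln[of p \<delta>] elim assms by auto
  qed
qed (auto intro!: measurable_from_borel)

lemma log_moment_mono:
  assumes "0 \<le> \<delta>" "\<delta> \<le> \<delta>'" "\<delta>' \<le> 1"
  shows "log_moment \<delta> \<le> log_moment \<delta>'"
  unfolding log_moment_def
proof (intro integral_mono_range integrable_ln_one_plus)
  fix p :: real assume p: "0 \<le> p" "p < 1"
  have "0 \<le> \<delta> / (1 - p)" "\<delta> / (1 - p) \<le> \<delta>' / (1 - p)" using p assms by (auto intro: divide_right_mono)
  then show "ln (1 + \<delta> / (1 - p)) \<le> ln (1 + \<delta>' / (1 - p))" by (subst ln_le_cancel_iff) auto
qed (use assms in auto)

lemma log_moment_small:
  assumes "0 < \<epsilon>"
  obtains \<delta> where "0 < \<delta>" "\<delta> \<le> 1" "\<And>\<delta>'. 0 \<le> \<delta>' \<Longrightarrow> \<delta>' \<le> \<delta> \<Longrightarrow> log_moment \<delta>' < \<epsilon>"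
proof -
  have "(\<lambda>k. \<integral>p. ln (1 + inverse (real (Suc k)) / (1 - p)) \<partial>\<Lambda>) \<longlonglongrightarrow> (\<integral>p. 0 \<partial>\<Lambda>)"
  proof (rule integral_dominated_convergence)
    show "integrable \<Lambda> (\<lambda>p. ln 2 + \<bar>ln (1 - p)\<bar>)" using integrable_abs_ln by simp
    show "AE p in \<Lambda>. (\<lambda>k. ln (1 + inverse (real (Suc k)) / (1 - p))) \<longlonglongrightarrow> 0"
    proof (rule AE_I2)
      fix p :: real
      have "(\<lambda>k. ln (1 + inverse (real (Suc k)) / (1 - p))) \<longlonglongrightarrow> ln (1 + 0 * inverse (1 - p))"
        unfolding divide_inverse
        by (intro tendsto_ln tendsto_add tendsto_const tendsto_mult LIMSEQ_inverse_real_of_nat) auto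
      then show "(\<lambda>k. ln (1 + inverse (real (Suc k)) / (1 - p))) \<longlonglongrightarrow> 0" by simp
    qed
    show "AE p in \<Lambda>. norm (ln (1 + inverse (real (Suc k)) / (1 - p))) \<le> ln 2 + \<bar>ln (1 - p)\<bar>" for k
      using AE_range
    proof eventually_elim
      case (elim p)
      have s: "inverse (real (Suc k)) \<le> 1" by (simp add: field_simps)
      have "0 \<le> ln (1 + inverse (real (Suc k)) / (1 - p))" using elim by (intro ln_ge_zero) auto
      then show ?case using ln_one_plus_le_abs_ln[of p "inverse (real (Suc k))"] elim s by auto
    qed
  qed (auto intro!: measurable_from_borel)
  then have "\<forall>\<^sub>F k in sequentially. log_moment (inverse (real (Suc k))) < \<epsilon>"
    unfolding log_moment_def using assms by (auto intro: order_tendstoD)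
  then obtain k where k: "log_moment (inverse (real (Suc k))) < \<epsilon>"
    by (auto simp: eventually_sequentially)
  show ?thesis
  proof (rule that[of "inverse (real (Suc k))"])
    show "log_moment \<delta>' < \<epsilon>" if "0 \<le> \<delta>'" "\<delta>' \<le> inverse (real (Suc k))" for \<delta>'
      using log_moment_mono[OF that] k by (simp add: field_simps)
  qed (auto simp: field_simps)
qed

text \<open>Two coupled coalescents, the second with one extra block, agree as soon as the extra block
  takes part in a merger. The rates \<open>\<alpha>\<close> and \<open>\<beta>\<close> are those of the mergers without and with it.\<close>

lemma harmonic_increment_bound:
  assumes harm: "\<And>x. J \<le> x \<Longrightarrow> harmonic_at u x" and J: "1 \<le> J"
    and u01: "\<And>x. 0 \<le> u x" "\<And>x. u x \<le> 1"
  shows "\<bar>u (Suc x) - u x\<bar> \<le> real J / (real x + 1)"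
proof (induction x rule: less_induct)
  case (less x)
  show ?case
  proof (cases "x < J")
    case True
    then have "1 \<le> real J / (real x + 1)" by simp
    moreover have "\<bar>u (Suc x) - u x\<bar> \<le> 1" using u01[of x] u01[of "Suc x"] by auto
    ultimately show ?thesis by linarith
  next
    case False
    then have x: "J \<le> x" "1 \<le> x" using J by auto
    define d where "d i = u (Suc i) - u i" for i
    define \<alpha> where "\<alpha> i = real (Suc x choose i) * mixed_moment (x - 1 - i) (Suc i)" for i
    define \<beta> where "\<beta> i = real (Suc x choose i) * mixed_moment (x - i) i" for i
    have pos: "0 \<le> \<alpha> i" "0 \<le> \<beta> i" for i by (auto simp: \<alpha>_def \<beta>_def mixed_moment_nonneg)
    have w1: "jump_rate x i = \<alpha> i + \<beta> i" if "i < x" for i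
    proof -
      have "x - i = Suc (x - 1 - i)" using that by auto
      then show ?thesis
        using mixed_moment_split[of "x - 1 - i" i] by (simp add: jump_rate_eq \<alpha>_def \<beta>_def ring_distribs)
    qed
    have w20: "jump_rate (Suc x) 0 = \<beta> 0" by (simp add: jump_rate_eq \<beta>_def)
    have w2: "jump_rate (Suc x) (Suc i) = \<beta> (Suc i) + \<alpha> i" if "i < x" for i
    proof -
      have "Suc x - 1 - Suc i = x - Suc i" "x - 1 - i = x - Suc i" by auto
      then show ?thesis by (simp add: jump_rate_eq \<alpha>_def \<beta>_def ring_distribs)
    qed
    have "0 = (\<Sum>i<Suc x. jump_rate (Suc x) i * (u (Suc x) - u i))"
      using harm[of "Suc x"] x by (simp add: harmonic_at_def)
    also have "\<dots> = \<beta> 0 * (u (Suc x) - u 0) + (\<Sum>i<x. (\<beta> (Suc i) + \<alpha> i) * (u (Suc x) - u (Suc i)))"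
      unfolding sum.lessThan_Suc_shift w20 by (simp add: w2)
    also have "\<dots> = \<beta> 0 * (u (Suc x) - u 0) + (\<Sum>i<x. \<beta> (Suc i) * (u (Suc x) - u (Suc i)))
        + (\<Sum>i<x. \<alpha> i * (u (Suc x) - u (Suc i)))"
      by (simp add: ring_distribs sum.distrib sum_subtractf)
    also have "\<beta> 0 * (u (Suc x) - u 0) + (\<Sum>i<x. \<beta> (Suc i) * (u (Suc x) - u (Suc i)))
        = (\<Sum>i<Suc x. \<beta> i * (u (Suc x) - u i))"
      unfolding sum.lessThan_Suc_shift by simp
    finally have E1: "(\<Sum>i<Suc x. \<beta> i * (u (Suc x) - u i)) + (\<Sum>i<x. \<alpha> i * (u (Suc x) - u (Suc i))) = 0"
      by simp
    have "0 = (\<Sum>i<x. jump_rate x i * (u x - u i))"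
      using harm[of x] x by (simp add: harmonic_at_def)
    also have "\<dots> = (\<Sum>i<x. \<alpha> i * (u x - u i)) + (\<Sum>i<Suc x. \<beta> i * (u x - u i))"
      by (simp add: w1 ring_distribs sum.distrib sum_subtractf)
    finally have E2: "(\<Sum>i<Suc x. \<beta> i * (u x - u i)) + (\<Sum>i<x. \<alpha> i * (u x - u i)) = 0" by simp
    have "(\<Sum>i<Suc x. \<beta> i * (u (Suc x) - u i)) - (\<Sum>i<Suc x. \<beta> i * (u x - u i)) = (\<Sum>i<Suc x. \<beta> i) * d x"
      unfolding sum_subtractf[symmetric] sum_distrib_right d_def by (intro sum.cong) (auto simp: algebra_simps)
    moreover have "(\<Sum>i<x. \<alpha> i * (u (Suc x) - u (Suc i))) - (\<Sum>i<x. \<alpha> i * (u x - u i))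
        = (\<Sum>i<x. \<alpha> i) * d x - (\<Sum>i<x. \<alpha> i * d i)"
      unfolding sum_subtractf[symmetric] sum_distrib_right d_def by (intro sum.cong) (auto simp: algebra_simps)
    ultimately have E: "((\<Sum>i<Suc x. \<beta> i) + (\<Sum>i<x. \<alpha> i)) * d x = (\<Sum>i<x. \<alpha> i * d i)"
      using E1 E2 by (simp add: ring_distribs)
    have "(\<Sum>i<x. jump_rate x i) \<le> (\<Sum>i<Suc x. \<beta> i) + (\<Sum>i<x. \<alpha> i)"
      using w1 pos by (simp add: sum.distrib)
    then have T: "0 < (\<Sum>i<Suc x. \<beta> i) + (\<Sum>i<x. \<alpha> i)" (is "0 < ?T")
      using sum_jump_rate_pos[of x] x by linarith
    have ab: "\<alpha> i * (1 / (real i + 1)) \<le> (\<alpha> i + \<beta> (Suc i)) * (1 / (real x + 1))" if "i < x" for i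
    proof -
      have e: "x - 1 - i = x - Suc i" by simp
      have "(real i + 1) * real (Suc x choose Suc i) = (real x + 1 - real i) * real (Suc x choose i)"
        using arg_cong[OF Suc_times_binomial[of i x], of real] binomial_absorb_comp_real[of i "Suc x"] that
        by (simp add: algebra_simps del: binomial_Suc_Suc)
      then have "real (Suc x choose i) * ((real x - real i) / (real i + 1)) \<le> real (Suc x choose Suc i)"
        by (simp add: field_simps)
      from mult_right_mono[OF this mixed_moment_nonneg[of "x - Suc i" "Suc i"]]
      have "\<alpha> i * ((real x - real i) / (real i + 1)) \<le> \<beta> (Suc i)"
        unfolding \<alpha>_def \<beta>_def e by (simp add: mult_ac)
      then have "(\<alpha> i + \<alpha> i * ((real x - real i) / (real i + 1))) * (1 / (real x + 1))
          \<le> (\<alpha> i + \<beta> (Suc i)) * (1 / (real x + 1))" by (intro mult_right_mono) auto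
      moreover have "(\<alpha> i + \<alpha> i * ((real x - real i) / (real i + 1))) * (1 / (real x + 1))
         = \<alpha> i * (1 / (real i + 1))"
      proof -
        have "\<alpha> i + \<alpha> i * ((real x - real i) / (real i + 1)) = \<alpha> i * ((real x + 1) / (real i + 1))"
          by (simp add: field_simps)
        then show ?thesis by (simp add: add_nonneg_eq_0_iff)
      qed
      ultimately show ?thesis by simp
    qed
    have "?T * \<bar>d x\<bar> = \<bar>\<Sum>i<x. \<alpha> i * d i\<bar>" unfolding E[symmetric] using T by (simp add: abs_mult)
    also have "\<dots> \<le> (\<Sum>i<x. \<bar>\<alpha> i * d i\<bar>)" by (rule sum_abs)
    also have "\<dots> \<le> (\<Sum>i<x. real J * (\<alpha> i * (1 / (real i + 1))))"
    proof (intro sum_mono)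
      fix i assume "i \<in> {..<x}"
      then have "\<bar>d i\<bar> \<le> real J / (real i + 1)" using less unfolding d_def by simp
      from mult_left_mono[OF this pos(1)[of i]] pos(1)[of i]
      show "\<bar>\<alpha> i * d i\<bar> \<le> real J * (\<alpha> i * (1 / (real i + 1)))" by (simp add: abs_mult mult_ac)
    qed
    also have "\<dots> \<le> (\<Sum>i<x. real J * ((\<alpha> i + \<beta> (Suc i)) * (1 / (real x + 1))))"
      using ab by (intro sum_mono mult_left_mono) auto
    also have "\<dots> = real J * (1 / (real x + 1)) * ((\<Sum>i<x. \<alpha> i) + (\<Sum>i<x. \<beta> (Suc i)))"
      by (simp add: sum_distrib_left sum.distrib[symmetric] algebra_simps)
    also have "\<dots> \<le> real J * (1 / (real x + 1)) * ?T"
      using pos(2)[of 0] unfolding sum.lessThan_Suc_shift by (intro mult_left_mono) auto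
    finally have "?T * \<bar>d x\<bar> \<le> ?T * (real J / (real x + 1))" by (simp add: mult_ac)
    then have "\<bar>d x\<bar> \<le> real J / (real x + 1)" using T by (rule mult_left_le_imp_le)
    then show ?thesis unfolding d_def .
  qed
qed

lemma harmonic_log_Lipschitz:
  assumes harm: "\<And>x. J \<le> x \<Longrightarrow> harmonic_at u x" and J: "1 \<le> J"
    and u01: "\<And>x. 0 \<le> u x" "\<And>x. u x \<le> 1" and yx: "y \<le> x"
  shows "\<bar>u x - u y\<bar> \<le> real J * (real x - real y) / (real y + 1)"
proof -
  have "\<bar>u (y + n) - u y\<bar> \<le> real n * (real J / (real y + 1))" for n
  proof (induction n)
    case (Suc n)
    have "\<bar>u (Suc (y + n)) - u (y + n)\<bar> \<le> real J / (real (y + n) + 1)"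
      using harm J u01 by (rule harmonic_increment_bound)
    also have "\<dots> \<le> real J / (real y + 1)" by (intro divide_left_mono) auto
    finally have "\<bar>u (Suc (y + n)) - u (y + n)\<bar> \<le> real J / (real y + 1)" .
    moreover have "real (Suc n) * (real J / (real y + 1)) = real n * (real J / (real y + 1)) + real J / (real y + 1)"
      by (simp add: ring_distribs add_divide_distrib)
    ultimately show ?case using Suc by simp
  qed simp
  from this[of "x - y"] show ?thesis using yx by (simp add: of_nat_diff mult_ac)
qed

text \<open>The comparison function is a multiple of \<open>G 0 - G x\<close>, increasing and concave in \<open>x\<close>, so its
  decrease along a jump is controlled by the drift of the chain.\<close>

lemma undershoot_bound:
  assumes harm: "\<And>x. K \<le> x \<Longrightarrow> harmonic_at h x"
    and K: "1 \<le> K" "2 * m \<le> K"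
    and low: "\<And>i. i < m \<Longrightarrow> h i \<le> 1" and mid: "\<And>i. m \<le> i \<Longrightarrow> i < K \<Longrightarrow> h i \<le> 0"
    and x: "K \<le> x"
  shows "h x \<le> 48 / mass * log_moment (real m / real K)"
proof -
  define y where "y p = real m / (1 - p)" for p
  define \<phi> where "\<phi> x p = ln (1 + y p / (real x + real K))" for x :: nat and p
  define G where "G x = (\<integral>p. \<phi> x p \<partial>\<Lambda>)" for x
  define C where "C = 48 / mass"
  define H where "H x = C * (G 0 - G x)" for x
  define D where "D x = (\<integral>p. y p / (2 * real x + y p) \<partial>\<Lambda>)" for x :: nat
  have C: "0 < C" using mass_pos by (simp add: C_def)
  have y0: "0 \<le> y p" if "p < 1" for p using that by (simp add: y_def)
  have mK: "real m / (real x + real K) \<le> 1" for x :: nat using K by simp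
  have \<phi>_eq: "\<phi> x = (\<lambda>p. ln (1 + (real m / (real x + real K)) / (1 - p)))" for x
    by (auto simp: \<phi>_def y_def field_simps)
  have int\<phi>: "integrable \<Lambda> (\<phi> x)" for x
    unfolding \<phi>_eq using mK by (intro integrable_ln_one_plus) auto
  have G0: "G 0 = log_moment (real m / real K)"
    unfolding G_def log_moment_def \<phi>_eq by simp
  have Gnn: "0 \<le> G x" for x
    unfolding G_def
  proof (rule integral_nonneg_AE)
    show "AE p in \<Lambda>. 0 \<le> \<phi> x p" using AE_range
      by eventually_elim (use y0 in \<open>auto simp: \<phi>_def intro!: ln_ge_zero\<close>)
  qed
  have conc: "(real x - real i) * (y p / ((real x + real K) * (real x + real K + y p))) \<le> \<phi> i p - \<phi> x p"
    if "i \<le> x" "p < 1" for i x p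
  proof -
    define s t where "s = real i + real K" and "t = real x + real K"
    have st: "0 < s" "s \<le> t" using K that by (auto simp: s_def t_def)
    note yp = y0[OF that(2)]
    have pos: "0 < 1 + y p / s" "0 < 1 + y p / t" using st yp by (auto intro!: add_pos_nonneg)
    have "\<phi> i p - \<phi> x p = - ln ((1 + y p / t) / (1 + y p / s))"
      using pos by (simp add: \<phi>_def s_def t_def ln_div)
    also have "\<dots> \<ge> 1 - (1 + y p / t) / (1 + y p / s)"
      using ln_le_minus_one[of "(1 + y p / t) / (1 + y p / s)"] pos by simp
    also have "1 - (1 + y p / t) / (1 + y p / s) = (t - s) * (y p / (t * (s + y p)))"
    proof -
      have ne: "s + y p \<noteq> 0" "t \<noteq> 0" "s \<noteq> 0" "1 + y p / s \<noteq> 0" using st yp pos by auto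
      have "1 - (1 + y p / t) / (1 + y p / s) = (y p / s - y p / t) / (1 + y p / s)"
        using ne(4) by (simp add: diff_divide_distrib[symmetric] diff_divide_eq_iff)
      also have e: "1 + y p / s = (s + y p) / s" using ne by (simp add: field_simps)
      also have "y p / s - y p / t = y p * (t - s) / (s * t)" using ne by (simp add: field_simps)
      also have "(y p * (t - s) / (s * t)) / ((s + y p) / s) = (t - s) * (y p / (t * (s + y p)))"
        using ne by simp
      finally show ?thesis unfolding e .
    qed
    also have "(t - s) * (y p / (t * (s + y p))) \<ge> (t - s) * (y p / (t * (t + y p)))"
      using st yp by (intro mult_left_mono divide_left_mono mult_mono mult_pos_pos) auto
    finally show ?thesis by (simp add: s_def t_def)
  qed
  have intD: "integrable \<Lambda> (\<lambda>p. y p / (2 * real x + y p))" if "0 < x" for x :: nat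
  proof (rule integrable_bounded[where B = 1])
    show "(\<lambda>p. y p / (2 * real x + y p)) \<in> borel_measurable borel" unfolding y_def by measurable
    show "\<bar>y p / (2 * real x + y p)\<bar> \<le> 1" if "0 \<le> p" "p < 1" for p
      using y0[OF that(2)] by (simp add: divide_le_eq_1) linarith
  qed
  have Gdiff: "(real x - real i) / (2 * real x) * D x \<le> G i - G x" if "i < x" "K \<le> x" for i x
  proof -
    have "(real x - real i) / (2 * real x) * D x
        = (\<integral>p. (real x - real i) / (2 * real x) * (y p / (2 * real x + y p)) \<partial>\<Lambda>)"
      unfolding D_def integral_mult_right_zero ..
    also have "\<dots> \<le> (\<integral>p. \<phi> i p - \<phi> x p \<partial>\<Lambda>)"
    proof (rule integral_mono_range)
      show "integrable \<Lambda> (\<lambda>p. (real x - real i) / (2 * real x) * (y p / (2 * real x + y p)))"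
        using intD that by (intro integrable_mult_right) auto
      show "integrable \<Lambda> (\<lambda>p. \<phi> i p - \<phi> x p)" using int\<phi> by simp
      fix p :: real assume p: "0 \<le> p" "p < 1"
      note yp = y0[OF p(2)]
      have "(real x + real K) * (real x + real K + y p) \<le> (2 * real x) * (2 * real x + y p)"
        using that yp by (intro mult_mono) auto
      moreover have "0 < (real x + real K) * (real x + real K + y p)"
        using that yp by (intro mult_pos_pos) auto
      ultimately have "y p / ((2 * real x) * (2 * real x + y p)) \<le> y p / ((real x + real K) * (real x + real K + y p))"
        using yp that by (intro divide_left_mono mult_pos_pos) auto
      then have "(real x - real i) * (y p / ((2 * real x) * (2 * real x + y p)))
          \<le> (real x - real i) * (y p / ((real x + real K) * (real x + real K + y p)))"
        using that by (intro mult_left_mono) auto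
      also have "\<dots> \<le> \<phi> i p - \<phi> x p" using conc[of i x p] that p by simp
      finally show "(real x - real i) / (2 * real x) * (y p / (2 * real x + y p)) \<le> \<phi> i p - \<phi> x p" by simp
    qed
    also have "\<dots> = G i - G x" unfolding G_def using int\<phi> by simp
    finally show ?thesis .
  qed
  have Dnn: "0 \<le> D x" for x unfolding D_def
  proof (rule integral_nonneg_AE)
    show "AE p in \<Lambda>. 0 \<le> y p / (2 * real x + y p)" using AE_range
      by eventually_elim (use y0 in auto)
  qed
  have Ganti: "G x \<le> G i" if "i \<le> x" for i x unfolding G_def
  proof (rule integral_mono_range[OF int\<phi> int\<phi>])
    fix p :: real assume p: "0 \<le> p" "p < 1"
    have "0 \<le> (real x - real i) * (y p / ((real x + real K) * (real x + real K + y p)))"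
      using y0[OF p(2)] that by auto
    then show "\<phi> x p \<le> \<phi> i p" using conc[OF that p(2)] by linarith
  qed
  have Hnn: "0 \<le> H x" for x using C Ganti[of 0 x] by (simp add: H_def)
  have up: "h x \<le> H x + (if x < m then 1 else 0)" for x
  proof (induction x rule: less_induct)
    case (less x)
    show ?case
    proof (cases "x < K")
      case True
      then show ?thesis using low[of x] mid[of x] Hnn[of x] by (cases "x < m") auto
    next
      case False
      then have xK: "K \<le> x" "0 < x" using K by auto
      let ?W = "\<Sum>i<x. jump_rate x i"
      have "(\<Sum>i<m. jump_rate x i) \<le> 4 * (\<integral>p. min 1 (real m / (real x * (1 - p))) \<partial>\<Lambda>)"
        using xK K by (intro sum_jump_rate_low_le) auto
      also have "\<dots> \<le> 4 * (\<integral>p. 3 * (y p / (2 * real x + y p)) \<partial>\<Lambda>)"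
      proof (intro mult_left_mono integral_mono_range)
        show "integrable \<Lambda> (\<lambda>p. min 1 (real m / (real x * (1 - p))))"
          by (rule integrable_bounded[where B = 1]) auto
        show "integrable \<Lambda> (\<lambda>p. 3 * (y p / (2 * real x + y p)))" using intD xK by (intro integrable_mult_right) auto
        fix p :: real assume p: "0 \<le> p" "p < 1"
        note yp = y0[OF p(2)]
        have pos: "0 < 2 * real x + y p" using xK yp by auto
        have e: "real m / (real x * (1 - p)) = y p / real x" by (simp add: y_def)
        show "min 1 (real m / (real x * (1 - p))) \<le> 3 * (y p / (2 * real x + y p))"
        proof (cases "real x \<le> y p")
          case True
          then have "1 \<le> 3 * (y p / (2 * real x + y p))" using pos by (simp add: field_simps)
          then show ?thesis by simp
        next
          case False
          then have "y p * (2 * real x + y p) \<le> y p * (3 * real x)" using yp by (intro mult_left_mono) auto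
          then have "y p / real x \<le> 3 * (y p / (2 * real x + y p))" using pos xK by (simp add: field_simps)
          then show ?thesis unfolding e by simp
        qed
      qed auto
      also have "\<dots> = 12 * D x" unfolding D_def integral_mult_right_zero by simp
      finally have R: "(\<Sum>i<m. jump_rate x i) \<le> 12 * D x" .
      have "12 * D x \<le> C * (D x * mass / 4)" using mass_pos by (simp add: C_def)
      also have "\<dots> \<le> C * (D x / (2 * real x) * ((real x + 1) / 2 * mass))"
      proof (intro mult_left_mono)
        have "D x * mass / 4 * 1 \<le> D x * mass / 4 * ((real x + 1) / real x)"
          using Dnn[of x] mass_pos xK by (intro mult_left_mono) auto
        then show "D x * mass / 4 \<le> D x / (2 * real x) * ((real x + 1) / 2 * mass)"
          by (simp add: mult_ac)
      qed (use C in auto)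
      also have "\<dots> \<le> C * (D x / (2 * real x) * (\<Sum>i<x. jump_rate x i * (real x - real i)))"
        using C Dnn[of x] xK jump_rate_drift_ge_mass[of x] by (intro mult_left_mono) auto
      also have "\<dots> = C * (\<Sum>i<x. jump_rate x i * ((real x - real i) / (2 * real x) * D x))"
        by (simp add: sum_distrib_left mult_ac)
      also have "\<dots> \<le> C * (\<Sum>i<x. jump_rate x i * (G i - G x))"
        using C Gdiff xK by (intro mult_left_mono sum_mono jump_rate_nonneg) auto
      also have "\<dots> = (\<Sum>i<x. jump_rate x i * (H x - H i))"
        by (simp add: H_def sum_distrib_left algebra_simps)
      finally have key: "(\<Sum>i<m. jump_rate x i) \<le> (\<Sum>i<x. jump_rate x i * (H x - H i))"
        using R by simp
      have mx: "{..<m} \<subseteq> {..<x}" using K xK by auto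
      have "?W * h x = (\<Sum>i<x. jump_rate x i * h i)" using harm[OF xK(1)] by (simp add: harmonic_at_iff)
      also have "\<dots> \<le> (\<Sum>i<x. jump_rate x i * (H i + (if i < m then 1 else 0)))"
        using less by (intro sum_mono mult_left_mono jump_rate_nonneg) auto
      also have "\<dots> = (\<Sum>i<x. jump_rate x i * H i) + (\<Sum>i<x. if i \<in> {..<m} then jump_rate x i else 0)"
        unfolding sum.distrib[symmetric] by (intro sum.cong) (auto simp: ring_distribs)
      also have "(\<Sum>i<x. if i \<in> {..<m} then jump_rate x i else 0) = (\<Sum>i<m. jump_rate x i)"
        using mx by (intro sum.mono_neutral_cong_right) auto
      also have "(\<Sum>i<x. jump_rate x i * H i) + (\<Sum>i<m. jump_rate x i) \<le> ?W * H x"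
        using key by (simp add: right_diff_distrib sum_subtractf sum_distrib_right)
      finally have "h x \<le> H x" using sum_jump_rate_pos[OF xK(2)] by simp
      then show ?thesis by simp
    qed
  qed
  have "\<not> x < m" using x K by auto
  then have "h x \<le> C * (G 0 - G x)" using up[of x] by (simp add: H_def)
  also have "\<dots> \<le> C * G 0" using C Gnn[of x] by (intro mult_left_mono) auto
  finally show ?thesis unfolding C_def G0 .
qed

end

section \<open>Semigroups of the line and the support of the measure\<close>

lemma additive_semigroup_asymptotically_dense:
  fixes S :: "real set"
  assumes pos: "\<And>s. s \<in> S \<Longrightarrow> 0 < s" and add: "\<And>s t. s \<in> S \<Longrightarrow> t \<in> S \<Longrightarrow> s + t \<in> S"
    and nonlattice: "\<And>d. 0 < d \<Longrightarrow> \<not> S \<subseteq> range (\<lambda>z. real (Suc z) * d)"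
    and \<eta>: "0 < \<eta>"
  obtains s0 where "0 \<le> s0" "\<And>x. s0 \<le> x \<Longrightarrow> \<exists>s\<in>S. x \<le> s \<and> s \<le> x + \<eta>"
proof -
  define D where "D = {s - t | s t. s \<in> S \<and> t \<in> S}"
  have diff: "g - g' \<in> D" if gD: "g \<in> D" "g' \<in> D" for g g'
  proof -
    obtain s t s' t' where *: "g = s - t" "g' = s' - t'" "s \<in> S" "t \<in> S" "s' \<in> S" "t' \<in> S"
      using gD unfolding D_def by blast
    then have "g - g' = (s + t') - (t + s')" by simp
    then show ?thesis unfolding D_def using * add by blast
  qed
  have SD: "S \<subseteq> D"
  proof
    fix s assume "s \<in> S"
    then show "s \<in> D" unfolding D_def using add[of s s] by force
  qed
  have multD: "s - real n * c \<in> D" if "s \<in> D" "c \<in> D" for s c n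
  proof (induction n)
    case (Suc n)
    have "s - real (Suc n) * c = (s - real n * c) - c" by (simp add: algebra_simps)
    then show ?case using diff Suc that by metis
  qed (use that in simp)
  have multS: "s + real n * t \<in> S" if "s \<in> S" "t \<in> S" for s t n
  proof (induction n)
    case (Suc n)
    have "s + real (Suc n) * t = (s + real n * t) + t" by (simp add: algebra_simps)
    then show ?case using add Suc that by metis
  qed (use that in simp)
  have "\<exists>g\<in>D. 0 < g \<and> g \<le> \<eta>"
  proof (rule ccontr)
    assume no: "\<not> ?thesis"
    let ?P = "{g \<in> D. 0 < g}"
    have ne: "?P \<noteq> {}" using nonlattice[of 1] SD pos by force
    have bdd: "bdd_below ?P" by (rule bdd_belowI[of _ 0]) auto
    obtain c where c: "c \<in> D" "0 < c" "c < Inf ?P + \<eta>"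
      using cInf_lessD[OF ne, of "Inf ?P + \<eta>"] \<eta> by auto
    have min: "c \<le> g" if "g \<in> D" "0 < g" for g
    proof (rule ccontr)
      assume "\<not> c \<le> g"
      moreover have "Inf ?P \<le> g" using that bdd by (intro cInf_lower) auto
      ultimately have "c - g \<in> D" "0 < c - g" "c - g \<le> \<eta>" using c diff that by auto
      then show False using no by blast
    qed
    have "S \<subseteq> range (\<lambda>z. real (Suc z) * c)"
    proof
      fix s assume s: "s \<in> S"
      define n where "n = nat \<lfloor>s / c\<rfloor>"
      have n: "real n = of_int \<lfloor>s / c\<rfloor>" using pos[OF s] c by (simp add: n_def)
      have "real n \<le> s / c" "s / c < real n + 1" unfolding n by linarith+
      then have r: "0 \<le> s - real n * c" "s - real n * c < c" using c by (auto simp: field_simps)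
      have "s - real n * c = 0"
        using min[of "s - real n * c"] multD[of s c n] r s SD c by force
      then have e: "s = real n * c" by simp
      then have "n \<noteq> 0" using pos[OF s] by (cases n) auto
      then obtain z where "n = Suc z" using not0_implies_Suc by blast
      then show "s \<in> range (\<lambda>z. real (Suc z) * c)" using e by auto
    qed
    then show False using nonlattice c by blast
  qed
  then obtain s1 s2 where s: "s1 \<in> S" "s2 \<in> S" "s1 < s2" "s2 - s1 \<le> \<eta>" by (auto simp: D_def)
  define g where "g = s2 - s1"
  have g: "0 < g" "g \<le> \<eta>" using s by (auto simp: g_def)
  note s1 = pos[OF s(1)]
  obtain N where N: "s1 / g \<le> real N" using real_arch_simple by blast
  show ?thesis
  proof (rule that[of "real (Suc N) * s1"])
    show "0 \<le> real (Suc N) * s1" using s1 by simp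
    fix x assume x: "real (Suc N) * s1 \<le> x"
    define n where "n = nat \<lfloor>x / s1\<rfloor>"
    have xs: "real (Suc N) \<le> x / s1" using x s1 by (simp add: field_simps)
    then have n: "real n = of_int \<lfloor>x / s1\<rfloor>" unfolding n_def by simp
    have "real n \<le> x / s1" "x / s1 < real n + 1" unfolding n by linarith+
    then have r: "0 \<le> x - real n * s1" "x - real n * s1 < s1" using s1 by (auto simp: field_simps)
    have nN: "Suc N \<le> n" using xs n_def by (metis le_nat_floor)
    define j where "j = nat \<lceil>(x - real n * s1) / g\<rceil>"
    have "0 \<le> (x - real n * s1) / g" using r g by simp
    then have j: "real j = of_int \<lceil>(x - real n * s1) / g\<rceil>" unfolding j_def by simp
    have "(x - real n * s1) / g \<le> real j" "real j < (x - real n * s1) / g + 1" unfolding j by linarith+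
    then have jg: "x - real n * s1 \<le> real j * g" "real j * g \<le> x - real n * s1 + g"
      using g by (auto simp: field_simps)
    have "(x - real n * s1) / g \<le> s1 / g" using r g by (intro divide_right_mono) auto
    then have "(x - real n * s1) / g \<le> real N" using N by linarith
    then have "j \<le> N" unfolding j_def by (simp add: ceiling_le_iff nat_le_iff)
    then have jn: "Suc j \<le> n" using nN by simp
    have "(s1 + real (n - Suc j) * s1) + real j * s2 \<in> S"
      using s multS by blast
    moreover have "(s1 + real (n - Suc j) * s1) + real j * s2 = real n * s1 + real j * g"
      using jn by (simp add: g_def of_nat_diff algebra_simps)
    ultimately show "\<exists>s\<in>S. x \<le> s \<and> s \<le> x + \<eta>" using jg g by (intro bexI[of _ "real n * s1 + real j * g"]) auto
  qed
qed

context log_integrable_measure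
begin

definition in_support :: "real \<Rightarrow> bool" where
  "in_support p \<longleftrightarrow> (\<forall>e>0. 0 < measure \<Lambda> {p - e<..<p + e})"

lemma AE_in_support: "AE p in \<Lambda>. in_support p"
proof -
  define R where "R = {r \<in> \<rat> \<times> \<rat>. emeasure \<Lambda> {fst r<..<snd r} = 0}"
  define U where "U = (\<Union>r\<in>R. {fst r<..<snd r})"
  have "countable R"
    unfolding R_def by (intro countable_Collect countable_SIGMA countable_rat)
  then have U: "U \<in> null_sets \<Lambda>"
    unfolding U_def using sets_eq_borel by (intro null_sets_UN') (auto simp: R_def null_sets_def)
  have "p \<in> U" if np: "\<not> in_support p" for p
  proof -
    obtain e where e: "0 < e" "\<not> 0 < measure \<Lambda> {p - e<..<p + e}"
      using np unfolding in_support_def by blast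
    then have e0: "measure \<Lambda> {p - e<..<p + e} = 0" using measure_nonneg[of \<Lambda> "{p - e<..<p + e}"] by linarith
    obtain a where a: "a \<in> \<rat>" "p - e < a" "a < p" using Rats_dense_in_real[of "p - e" p] e by auto
    obtain b where b: "b \<in> \<rat>" "p < b" "b < p + e" using Rats_dense_in_real[of p "p + e"] e by auto
    have "emeasure \<Lambda> {a<..<b} \<le> emeasure \<Lambda> {p - e<..<p + e}"
      using sets_eq_borel a b by (intro emeasure_mono) auto
    then have "emeasure \<Lambda> {a<..<b} = 0" using e0 by (simp add: emeasure_eq_measure)
    then have "(a, b) \<in> R" using a b by (simp add: R_def)
    then show ?thesis unfolding U_def using a b by (intro UN_I[of "(a, b)"]) auto
  qed
  then show ?thesis by (intro AE_I'[OF U]) auto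
qed

lemma sum_jump_rate_low_small:
  assumes "0 < \<kappa>"
  obtains N where "\<And>n. N \<le> n \<Longrightarrow> (\<Sum>i<m. jump_rate n i) < \<kappa>"
proof -
  obtain \<delta> where \<delta>: "0 < \<delta>" "\<delta> \<le> 1" "\<And>\<delta>'. 0 \<le> \<delta>' \<Longrightarrow> \<delta>' \<le> \<delta> \<Longrightarrow> log_moment \<delta>' < \<kappa> / 8"
    using log_moment_small[of "\<kappa> / 8"] assms by auto
  obtain N where N: "max (2 * real m + 1) (real m / \<delta>) \<le> real N" using real_arch_simple by blast
  show ?thesis
  proof (rule that[of N])
    fix n assume n: "N \<le> n"
    have n1: "2 * m \<le> n" "0 < n" "real m / \<delta> \<le> real n" using N n by auto
    have d: "0 \<le> real m / real n" "real m / real n \<le> \<delta>" using n1 \<delta> by (auto simp: field_simps)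
    have "(\<Sum>i<m. jump_rate n i) \<le> 4 * (\<integral>p. min 1 (real m / (real n * (1 - p))) \<partial>\<Lambda>)"
      using n1 by (intro sum_jump_rate_low_le) auto
    also have "\<dots> \<le> 4 * (\<integral>p. 2 * ln (1 + (real m / real n) / (1 - p)) \<partial>\<Lambda>)"
    proof (intro mult_left_mono integral_mono_range)
      show "integrable \<Lambda> (\<lambda>p. min 1 (real m / (real n * (1 - p))))"
        by (rule integrable_bounded[where B = 1]) auto
      show "integrable \<Lambda> (\<lambda>p. 2 * ln (1 + real m / real n / (1 - p)))"
        using d \<delta> by (intro integrable_mult_right integrable_ln_one_plus) auto
      fix p :: real assume p: "0 \<le> p" "p < 1"
      define z where "z = (real m / real n) / (1 - p)"
      have z0: "0 \<le> z" using p by (simp add: z_def)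
      have "min 1 z \<le> 2 * (z / (1 + z))"
        using z0 by (cases "z \<le> 1") (auto simp: field_simps mult_left_le)
      also have "z / (1 + z) \<le> ln (1 + z)"
      proof -
        have "ln (inverse (1 + z)) \<le> inverse (1 + z) - 1" using z0 by (intro ln_le_minus_one) auto
        moreover have "inverse (1 + z) - 1 = - (z / (1 + z))" using z0 by (simp add: field_simps)
        ultimately show ?thesis using z0 by (simp add: ln_inverse)
      qed
      finally show "min 1 (real m / (real n * (1 - p))) \<le> 2 * ln (1 + (real m / real n) / (1 - p))"
        by (simp add: z_def)
    qed auto
    also have "\<dots> = 8 * log_moment (real m / real n)" unfolding log_moment_def integral_mult_right_zero by simp
    also have "\<dots> < \<kappa>" using \<delta>(3)[OF d] by simp
    finally show "(\<Sum>i<m. jump_rate n i) < \<kappa>" .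
  qed
qed

lemma AE_pos_of_summable:
  assumes "summable (mixed_moment 0)"
  shows "AE p in \<Lambda>. 0 < p"
proof -
  have "measure \<Lambda> {0} \<le> mixed_moment 0 l" for l
  proof -
    have "measure \<Lambda> {0} = (\<integral>p. indicator {0} p \<partial>\<Lambda>)" using sets_eq_borel by simp
    also have "\<dots> \<le> (\<integral>p. p ^ 0 * (1 - p) ^ l \<partial>\<Lambda>)"
    proof (rule integral_mono_range[OF _ integrable_mixed])
      show "integrable \<Lambda> (indicator {0} :: real \<Rightarrow> real)"
        by (rule integrable_real_indicator) (auto simp: sets_eq_borel emeasure_eq_measure)
    qed (auto simp: indicator_def)
    finally show ?thesis by (simp add: mixed_moment_def)
  qed
  then have "measure \<Lambda> {0} \<le> 0"
    using summable_LIMSEQ_zero[OF assms] by (intro LIMSEQ_le_const) auto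
  then have "emeasure \<Lambda> {0} = 0" using emeasure_eq_measure measure_nonneg[of \<Lambda> "{0}"] by simp
  then have "AE p in \<Lambda>. p \<noteq> 0" using sets_eq_borel by (intro AE_I[of _ _ "{0}"]) auto
  then show ?thesis using AE_range by eventually_elim auto
qed

lemma integrable_inverse_of_summable:
  assumes "summable (mixed_moment 0)"
  shows "integrable \<Lambda> (\<lambda>p. 1 / p)"
proof (rule integrableI_bounded)
  show "(\<lambda>p. 1 / p) \<in> borel_measurable \<Lambda>" by (intro measurable_from_borel) auto
  have "(\<integral>\<^sup>+p. ennreal (norm (1 / p)) \<partial>\<Lambda>) = (\<integral>\<^sup>+p. (\<Sum>l. ennreal (\<bar>1 - p\<bar> ^ l)) \<partial>\<Lambda>)"
  proof (rule nn_integral_cong_AE)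
    show "AE p in \<Lambda>. ennreal (norm (1 / p)) = (\<Sum>l. ennreal (\<bar>1 - p\<bar> ^ l))"
      using AE_range AE_pos_of_summable[OF assms]
    proof eventually_elim
      case (elim p)
      have "(\<lambda>l. (1 - p) ^ l) sums (1 / p)" using geometric_sums[of "1 - p"] elim by simp
      then show ?case using elim by (subst suminf_ennreal_eq[of _ "1 / p"]) auto
    qed
  qed
  also have "\<dots> = (\<Sum>l. \<integral>\<^sup>+p. ennreal (\<bar>1 - p\<bar> ^ l) \<partial>\<Lambda>)"
    by (intro nn_integral_suminf measurable_from_borel) auto
  also have "\<dots> = (\<Sum>l. ennreal (mixed_moment 0 l))"
  proof (intro arg_cong[where f = suminf] ext)
    fix l
    have "(\<integral>\<^sup>+p. ennreal (\<bar>1 - p\<bar> ^ l) \<partial>\<Lambda>) = (\<integral>\<^sup>+p. ennreal (p ^ 0 * (1 - p) ^ l) \<partial>\<Lambda>)"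
    proof (rule nn_integral_cong_AE)
      show "AE p in \<Lambda>. ennreal (\<bar>1 - p\<bar> ^ l) = ennreal (p ^ 0 * (1 - p) ^ l)"
        using AE_range by eventually_elim auto
    qed
    also have "\<dots> = ennreal (mixed_moment 0 l)" unfolding mixed_moment_def
    proof (rule nn_integral_eq_integral[OF integrable_mixed])
      show "AE p in \<Lambda>. 0 \<le> p ^ 0 * (1 - p) ^ l" using AE_range by eventually_elim auto
    qed
    finally show "(\<integral>\<^sup>+p. ennreal (\<bar>1 - p\<bar> ^ l) \<partial>\<Lambda>) = ennreal (mixed_moment 0 l)" .
  qed
  also have "\<dots> < \<infinity>"
    by (subst suminf_ennreal_eq[OF mixed_moment_nonneg summable_sums[OF assms]]) auto
  finally show "(\<integral>\<^sup>+p. ennreal (norm (1 / p)) \<partial>\<Lambda>) < \<infinity>" .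
qed

lemma near_drift_small:
  assumes "summable (mixed_moment 0)" "0 < \<kappa>" "0 < \<eta>0"
  obtains \<eta> where "0 < \<eta>" "\<eta> \<le> \<eta>0"
    "\<And>x I. 1 \<le> \<eta> * real x \<Longrightarrow> I \<subseteq> {..<x} \<Longrightarrow> (\<And>i. i \<in> I \<Longrightarrow> real x - real i \<le> \<eta> * real x) \<Longrightarrow>
       (\<Sum>i\<in>I. jump_rate x i * (real x - real i)) \<le> (real x + 1) * \<kappa>"
proof -
  define f where "f \<eta> p = min 1 (2 * \<eta> / p) / p" for \<eta> p :: real
  note pos = AE_pos_of_summable[OF assms(1)] and inv = integrable_inverse_of_summable[OF assms(1)]
  have bnd: "AE p in \<Lambda>. norm (f \<eta> p) \<le> 1 / p" if "0 < \<eta>" for \<eta>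
    using pos by eventually_elim (use that in \<open>auto simp: f_def divide_right_mono\<close>)
  have meas: "f \<eta> \<in> borel_measurable \<Lambda>" for \<eta>
    unfolding f_def by (intro measurable_from_borel) simp
  have intf: "integrable \<Lambda> (f \<eta>)" if "0 < \<eta>" for \<eta>
  proof (rule Bochner_Integration.integrable_bound[OF inv meas])
    show "AE p in \<Lambda>. norm (f \<eta> p) \<le> norm (1 / p)"
      using bnd[OF that] pos by eventually_elim auto
  qed
  have "(\<lambda>k. \<integral>p. f (\<eta>0 * inverse (real (Suc k))) p \<partial>\<Lambda>) \<longlonglongrightarrow> (\<integral>p. 0 \<partial>\<Lambda>)"
  proof (rule integral_dominated_convergence[OF _ meas inv])
    show "AE p in \<Lambda>. (\<lambda>k. f (\<eta>0 * inverse (real (Suc k))) p) \<longlonglongrightarrow> 0"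
      using pos
    proof eventually_elim
      case (elim p)
      have "(\<lambda>k. min 1 (2 * (\<eta>0 * inverse (real (Suc k))) / p) / p) \<longlonglongrightarrow> min 1 (2 * (\<eta>0 * 0) / p) / p"
        using elim by (intro tendsto_divide tendsto_min tendsto_mult tendsto_const LIMSEQ_inverse_real_of_nat) auto
      then show ?case by (simp add: f_def)
    qed
    show "AE p in \<Lambda>. norm (f (\<eta>0 * inverse (real (Suc k))) p) \<le> 1 / p" for k
      using assms by (intro bnd) auto
  qed auto
  then have "\<forall>\<^sub>F k in sequentially. (\<integral>p. f (\<eta>0 * inverse (real (Suc k))) p \<partial>\<Lambda>) < \<kappa>"
    using assms by (auto intro: order_tendstoD)
  then obtain k where k: "(\<integral>p. f (\<eta>0 * inverse (real (Suc k))) p \<partial>\<Lambda>) < \<kappa>"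
    by (auto simp: eventually_sequentially)
  define \<eta> where "\<eta> = \<eta>0 * inverse (real (Suc k))"
  have \<eta>: "0 < \<eta>" "\<eta> \<le> \<eta>0" using assms by (auto simp: \<eta>_def field_simps)
  show ?thesis
  proof (rule that[OF \<eta>])
    fix x I assume x: "1 \<le> \<eta> * real x" and I: "I \<subseteq> {..<x}" "\<And>i. i \<in> I \<Longrightarrow> real x - real i \<le> \<eta> * real x"
    have "finite I" using I finite_subset by blast
    then have "(\<Sum>i\<in>I. jump_rate x i * (real x - real i))
        = (\<integral>p. (\<Sum>i\<in>I. merge_density x i p * (real x - real i)) \<partial>\<Lambda>)" by (rule sum_jump_rate)
    also have "\<dots> \<le> (\<integral>p. (real x + 1) * f \<eta> p \<partial>\<Lambda>)"
    proof (rule integral_mono_AE)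
      show "AE p in \<Lambda>. (\<Sum>i\<in>I. merge_density x i p * (real x - real i)) \<le> (real x + 1) * f \<eta> p"
        using pos AE_range
      proof eventually_elim
        case (elim p)
        then show ?case unfolding f_def using \<eta> x I by (intro merge_density_near_drift_le) auto
      qed
    qed (auto intro!: integrable_sum_merge_density intf integrable_mult_right \<eta>)
    also have "\<dots> = (real x + 1) * (\<integral>p. f \<eta> p \<partial>\<Lambda>)" by simp
    also have "\<dots> \<le> (real x + 1) * \<kappa>" using k by (intro mult_left_mono) (auto simp: \<eta>_def)
    finally show "(\<Sum>i\<in>I. jump_rate x i * (real x - real i)) \<le> (real x + 1) * \<kappa>" .
  qed
qed

lemma sum_jump_rate_window_ge:
  assumes p0: "0 < p0" "p0 < 1" and e: "0 < e" and x: "1 \<le> e * real x" "1 \<le> e\<^sup>2 * real x"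
  shows "measure \<Lambda> {p0 - e<..<p0 + e} / 2
    \<le> (\<Sum>i | i < x \<and> \<bar>real i - (1 - p0) * real x\<bar> \<le> 4 * e * real x. jump_rate x i)" (is "_ \<le> sum _ ?W")
proof -
  have x0: "0 < x" using x by (cases x) auto
  have "measure \<Lambda> {p0 - e<..<p0 + e} / 2 = (\<integral>p. indicator {p0 - e<..<p0 + e} p * (1/2) \<partial>\<Lambda>)"
    using sets_eq_borel by simp
  also have "\<dots> \<le> (\<integral>p. (\<Sum>i\<in>?W. merge_density x i p) \<partial>\<Lambda>)"
  proof (rule integral_mono_range)
    show "integrable \<Lambda> (\<lambda>p. indicator {p0 - e<..<p0 + e} p * (1/2 :: real))"
      by (intro integrable_mult_left integrable_real_indicator) (auto simp: sets_eq_borel emeasure_eq_measure)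
    show "integrable \<Lambda> (\<lambda>p. \<Sum>i\<in>?W. merge_density x i p)"
      using integrable_sum_merge_density[of x "\<lambda>_. 1" ?W] by simp
    fix p :: real assume p: "0 \<le> p" "p < 1"
    have nn: "0 \<le> merge_density x i p" for i using p by (intro merge_density_nonneg) auto
    show "indicator {p0 - e<..<p0 + e} p * (1/2) \<le> (\<Sum>i\<in>?W. merge_density x i p)"
    proof (cases "p \<in> {p0 - e<..<p0 + e}")
      case True
      let ?V = "{i. i < x \<and> \<bar>real i - (1 - p) * real x\<bar> \<le> 3 * e * real x}"
      have "1 / 2 \<le> (\<Sum>i\<in>?V. Bernstein (x - 1) i (1 - p))"
        using p e x x0 by (intro sum_Bernstein_window_ge) auto
      also have "\<dots> \<le> (\<Sum>i\<in>?V. merge_density x i p)"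
        using p by (intro sum_mono Bernstein_le_merge_density) auto
      also have "\<dots> \<le> (\<Sum>i\<in>?W. merge_density x i p)"
      proof (intro sum_mono2)
        have "\<bar>(p - p0) * real x\<bar> \<le> e * real x"
          using True by (auto simp: abs_mult intro!: mult_right_mono)
        then show "?V \<subseteq> ?W" by (auto simp: algebra_simps)
      qed (auto simp: nn)
      finally show ?thesis using True by simp
    qed (auto intro!: sum_nonneg nn)
  qed
  also have "\<dots> = sum (jump_rate x) ?W" using sum_jump_rate[of ?W x "\<lambda>_. 1"] by simp
  finally show ?thesis .
qed

end

section \<open>Propagation of near-maximal values\<close>

lemma floor_approx:
  assumes "0 \<le> (z :: real)"
  shows "\<bar>real (nat \<lfloor>z\<rfloor>) - z\<bar> \<le> 1" "real (nat \<lfloor>z\<rfloor>) \<le> z" "z \<le> real (nat \<lfloor>z\<rfloor>) + 1"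
proof -
  have "real (nat \<lfloor>z\<rfloor>) = of_int \<lfloor>z\<rfloor>" using assms by simp
  then show "\<bar>real (nat \<lfloor>z\<rfloor>) - z\<bar> \<le> 1" "real (nat \<lfloor>z\<rfloor>) \<le> z" "z \<le> real (nat \<lfloor>z\<rfloor>) + 1" by linarith+
qed

locale eventually_harmonic = log_integrable_measure +
  fixes u :: "nat \<Rightarrow> real" and J :: nat and a :: real
  assumes harm: "\<And>x. J \<le> x \<Longrightarrow> harmonic_at u x" and J_pos: "1 \<le> J"
    and u_nonneg: "\<And>x. 0 \<le> u x" and u_le_1: "\<And>x. u x \<le> 1"
    and eventually_le: "\<And>\<epsilon>. 0 < \<epsilon> \<Longrightarrow> \<exists>N. \<forall>x\<ge>N. u x \<le> a + \<epsilon>"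
begin

definition propagates :: "real \<Rightarrow> bool" where
  "propagates \<theta> \<longleftrightarrow> (\<forall>\<epsilon>>0. \<exists>\<zeta>>0. \<exists>N. \<forall>n\<ge>N. \<forall>i.
     a - \<zeta> \<le> u n \<longrightarrow> \<bar>real i - \<theta> * real n\<bar> \<le> \<zeta> * real n \<longrightarrow> a - \<epsilon> \<le> u i)"

lemma u_diff_le:
  assumes "0 < R" "R \<le> real i + 1" "R \<le> real j + 1" "\<bar>real i - real j\<bar> \<le> d"
  shows "\<bar>u i - u j\<bar> \<le> real J * d / R"
proof -
  have *: "\<bar>u x - u y\<bar> \<le> real J * d / R" if "y \<le> x" "R \<le> real y + 1" "\<bar>real x - real y\<bar> \<le> d" for x y
  proof -
    have "\<bar>u x - u y\<bar> \<le> real J * (real x - real y) / (real y + 1)"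
      using harm J_pos u_nonneg u_le_1 that(1) by (rule harmonic_log_Lipschitz)
    also have "\<dots> \<le> real J * d / R"
      using that assms(1) by (intro frac_le mult_left_mono mult_nonneg_nonneg) auto
    finally show ?thesis .
  qed
  show ?thesis
  proof (cases "j \<le> i")
    case True
    then show ?thesis using * assms by blast
  next
    case False
    then show ?thesis using *[of i j] assms by (simp add: abs_minus_commute)
  qed
qed

lemma propagates_mult:
  assumes "0 < \<theta>" "0 < \<theta>'" "propagates \<theta>" "propagates \<theta>'"
  shows "propagates (\<theta> * \<theta>')"
  unfolding propagates_def
proof (intro allI impI)
  fix \<epsilon> :: real assume "0 < \<epsilon>"
  then obtain \<zeta>2 N2 where 2: "0 < \<zeta>2"
    "\<And>n i. N2 \<le> n \<Longrightarrow> a - \<zeta>2 \<le> u n \<Longrightarrow> \<bar>real i - \<theta>' * real n\<bar> \<le> \<zeta>2 * real n \<Longrightarrow> a - \<epsilon> \<le> u i"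
    using assms(4) unfolding propagates_def by meson
  then obtain \<zeta>1 N1 where 1: "0 < \<zeta>1"
    "\<And>n i. N1 \<le> n \<Longrightarrow> a - \<zeta>1 \<le> u n \<Longrightarrow> \<bar>real i - \<theta> * real n\<bar> \<le> \<zeta>1 * real n \<Longrightarrow> a - \<zeta>2 \<le> u i"
    using assms(3) unfolding propagates_def by meson
  define \<zeta> where "\<zeta> = min \<zeta>1 (\<zeta>2 * \<theta> / 4)"
  have \<zeta>: "0 < \<zeta>" "\<zeta> \<le> \<zeta>1" "\<zeta> \<le> \<zeta>2 * \<theta> / 4" using 1 2 assms by (auto simp: \<zeta>_def)
  obtain N where N: "max (max (real N1) (1 / \<zeta>1)) (max (max ((real N2 + 1) / \<theta>) (2 / \<theta>)) (4 * \<theta>' / (\<zeta>2 * \<theta>))) \<le> real N"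
    using real_arch_simple by blast
  have "a - \<epsilon> \<le> u i" if n: "N \<le> n" and un: "a - \<zeta> \<le> u n" and i: "\<bar>real i - \<theta> * \<theta>' * real n\<bar> \<le> \<zeta> * real n" for n i
  proof -
    have nN: "N1 \<le> n" "1 / \<zeta>1 \<le> real n" "(real N2 + 1) / \<theta> \<le> real n" "2 / \<theta> \<le> real n" "4 * \<theta>' / (\<zeta>2 * \<theta>) \<le> real n"
      using order_trans[OF N of_nat_mono[OF n]] by auto
    then have nn: "1 \<le> \<zeta>1 * real n" "real N2 + 1 \<le> \<theta> * real n" "2 \<le> \<theta> * real n" "4 * \<theta>' \<le> \<zeta>2 * (\<theta> * real n)"
      using 1(1) 2(1) assms by (auto simp: divide_le_eq mult_ac)
    define j where "j = nat \<lfloor>\<theta> * real n\<rfloor>"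
    have "0 \<le> \<theta> * real n" using assms by simp
    note j = floor_approx(1,3)[OF this, folded j_def]
    have uj: "a - \<zeta>2 \<le> u j"
      using 1(2)[OF nN(1), of j] un \<zeta> j nn by linarith
    have jN2: "N2 \<le> j" using nn j by linarith
    have "\<bar>\<theta>' * (\<theta> * real n - real j)\<bar> \<le> \<theta>' * 1"
      unfolding abs_mult using assms j by (intro mult_mono) auto
    moreover have "real i - \<theta>' * real j = (real i - \<theta> * \<theta>' * real n) + \<theta>' * (\<theta> * real n - real j)"
      by (simp add: algebra_simps)
    ultimately have "\<bar>real i - \<theta>' * real j\<bar> \<le> \<zeta> * real n + \<theta>'" using i by linarith
    also have "\<zeta> * real n \<le> \<zeta>2 * \<theta> / 4 * real n" using \<zeta> by (intro mult_right_mono) auto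
    also have "\<zeta>2 * \<theta> / 4 * real n + \<theta>' \<le> \<zeta>2 * (\<theta> * real n / 2)" using nn by (simp add: algebra_simps)
    also have "\<dots> \<le> \<zeta>2 * real j" using 2(1) j nn by (intro mult_left_mono) auto
    finally show ?thesis using 2(2)[OF jN2 uj] by simp
  qed
  then show "\<exists>\<zeta>>0. \<exists>N. \<forall>n\<ge>N. \<forall>i. a - \<zeta> \<le> u n \<longrightarrow> \<bar>real i - \<theta> * \<theta>' * real n\<bar> \<le> \<zeta> * real n \<longrightarrow> a - \<epsilon> \<le> u i"
    using \<zeta>(1) by blast
qed

text \<open>Without dust the drift of the small jumps dominates the rate of macroscopic jumps, so on its
  way down from \<open>n\<close> the chain does not jump over a window around \<open>q * n\<close>.\<close>

lemma propagates_no_dust: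
  assumes ns: "\<not> summable (mixed_moment 0)" and q: "0 < q" "q < 1"
  shows "propagates q"
  unfolding propagates_def
proof (intro allI impI)
  fix \<epsilon> :: real assume \<epsilon>: "0 < \<epsilon>"
  define \<eta> where "\<eta> = min (q / 4) (\<epsilon> * q / (4 * real J))"
  define \<zeta> where "\<zeta> = min \<eta> (\<epsilon> / 8)"
  have \<eta>: "0 < \<eta>" "\<eta> \<le> q / 4" "\<eta> \<le> \<epsilon> * q / (4 * real J)" using q \<epsilon> J_pos by (auto simp: \<eta>_def)
  have \<zeta>: "0 < \<zeta>" "\<zeta> \<le> \<eta>" "\<zeta> \<le> \<epsilon> / 8" using \<eta> \<epsilon> by (auto simp: \<zeta>_def)
  define B where "B = 16 * mass / (\<epsilon> * q * \<eta>\<^sup>2)"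
  obtain X where X: "B < (\<Sum>l<X. mixed_moment 0 l)"
    using summableI_nonneg_bounded[of "mixed_moment 0" B] mixed_moment_nonneg ns by (metis not_le)
  have XB: "B \<le> (\<Sum>l<x. mixed_moment 0 l)" if "X \<le> x" for x
  proof -
    have "(\<Sum>l<X. mixed_moment 0 l) \<le> (\<Sum>l<x. mixed_moment 0 l)"
      using that by (intro sum_mono2) (auto simp: mixed_moment_nonneg)
    then show ?thesis using X by linarith
  qed
  obtain N where N: "max 1 (max (2 * real X / q) (2 * real J / q)) \<le> real N" using real_arch_simple by blast
  have "a - \<epsilon> \<le> u i0"
    if n: "N \<le> n" and un: "a - \<zeta> \<le> u n" and i0: "\<bar>real i0 - q * real n\<bar> \<le> \<zeta> * real n" for n i0
  proof (rule ccontr)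
    assume "\<not> a - \<epsilon> \<le> u i0"
    then have ui0: "u i0 < a - \<epsilon>" by simp
    then have a: "\<epsilon> < a" using u_nonneg[of i0] by linarith
    have "1 \<le> real n" "2 * real X / q \<le> real n" "2 * real J / q \<le> real n" using order_trans[OF N of_nat_mono[OF n]] by auto
    then have nn: "1 \<le> real n" "2 * real X \<le> q * real n" "2 * real J \<le> q * real n"
      using q by (auto simp: divide_le_eq mult_ac)
    have \<zeta>n: "\<zeta> * real n \<le> \<eta> * real n" "\<eta> * real n \<le> q / 4 * real n"
      using mult_right_mono[OF \<zeta>(2), of "real n"] mult_right_mono[OF \<eta>(2), of "real n"] by simp_all
    have i0l: "q * real n / 2 \<le> real i0 - \<eta> * real n" using i0 \<zeta>n by linarith
    define f where "f x = a - \<epsilon> / 2 + \<epsilon> / 4 * (real x / real n)" for x :: nat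
    have f0: "0 \<le> f x" for x using a \<epsilon> nn by (auto simp: f_def intro!: add_nonneg_nonneg)
    have "u x \<le> f x" if "real i0 - \<eta> * real n \<le> real x" "x \<le> n" for x
      using that
    proof (induction x rule: less_induct)
      case (less x)
      show ?case
      proof (cases "x \<le> i0")
        case True
        have "\<bar>u x - u i0\<bar> \<le> real J * (\<eta> * real n) / (q * real n / 2)"
          using less.prems True i0l nn q \<eta> by (intro u_diff_le) auto
        also have "\<dots> = real J * (2 / q) * \<eta>" using nn q by (simp add: field_simps)
        also have "\<dots> \<le> real J * (2 / q) * (\<epsilon> * q / (4 * real J))" using q \<eta> by (intro mult_left_mono) auto
        also have "\<dots> = \<epsilon> / 2" using q J_pos by (simp add: field_simps)
        finally have "u x \<le> a - \<epsilon> / 2" using ui0 by linarith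
        also have "\<dots> \<le> f x" using \<epsilon> by (simp add: f_def)
        finally show ?thesis .
      next
        case False
        then have xi: "i0 < x" by simp
        let ?W = "\<Sum>i<x. jump_rate x i"
        let ?I = "{i. i < x \<and> real i < real i0 - \<eta> * real n}"
        have xq: "q * real n / 2 \<le> real x" using less.prems i0l by linarith
        have xJX: "J \<le> x" "X \<le> x" "0 < x" using xq nn J_pos by linarith+
        have far: "sum (jump_rate x) ?I \<le> mass / \<eta>\<^sup>2"
        proof (rule sum_jump_rate_far_le)
          have "\<eta> * real x \<le> \<eta> * real n" using less.prems \<eta> by (intro mult_left_mono) auto
          then show "\<eta> * real x \<le> real x - real i" if "i \<in> ?I" for i using that xi by auto
        qed (use xJX \<eta> in auto)
        have "mass / \<eta>\<^sup>2 = \<epsilon> / (4 * real n) * (q * real n / 2 / 2 * B)"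
          using nn \<epsilon> q \<eta> by (simp add: B_def field_simps)
        also have "\<dots> \<le> \<epsilon> / (4 * real n) * ((real x + 1) / 2 * (\<Sum>l<x. mixed_moment 0 l))"
          using \<epsilon> xq XB[OF xJX(2)] mass_pos q by (intro mult_left_mono mult_mono) (auto simp: B_def)
        also have "\<dots> \<le> \<epsilon> / (4 * real n) * (\<Sum>i<x. jump_rate x i * (real x - real i))"
          using \<epsilon> by (intro mult_left_mono jump_rate_drift_ge) auto
        finally have drift: "mass / \<eta>\<^sup>2 \<le> \<epsilon> / (4 * real n) * (\<Sum>i<x. jump_rate x i * (real x - real i))" .
        have "?W * u x = (\<Sum>i<x. jump_rate x i * u i)" using harm[OF xJX(1)] by (simp add: harmonic_at_iff)
        also have "\<dots> \<le> (\<Sum>i<x. jump_rate x i * f i + (if i \<in> ?I then jump_rate x i else 0))"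
        proof (intro sum_mono)
          fix i assume i: "i \<in> {..<x}"
          have "u i \<le> f i + (if i \<in> ?I then 1 else 0)"
          proof (cases "i \<in> ?I")
            case True
            then show ?thesis using u_le_1[of i] f0[of i] by simp
          next
            case False
            then have "u i \<le> f i" using i less by auto
            then show ?thesis using False by simp
          qed
          from mult_left_mono[OF this jump_rate_nonneg[of x i]]
          show "jump_rate x i * u i \<le> jump_rate x i * f i + (if i \<in> ?I then jump_rate x i else 0)"
            by (auto simp: ring_distribs split: if_splits)
        qed
        also have "\<dots> = (\<Sum>i<x. jump_rate x i * f i) + sum (jump_rate x) ?I"
          unfolding sum.distrib by (intro arg_cong2[where f = "(+)"] refl sum.mono_neutral_cong_right) auto
        also have "(\<Sum>i<x. jump_rate x i * f i) = ?W * f x - \<epsilon> / (4 * real n) * (\<Sum>i<x. jump_rate x i * (real x - real i))"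
          unfolding sum_distrib_left sum_distrib_right sum_subtractf[symmetric]
          using nn by (intro sum.cong refl) (simp add: f_def field_simps)
        finally have "?W * u x \<le> ?W * f x" using far drift by linarith
        then show ?thesis using sum_jump_rate_pos[OF xJX(3)] by simp
      qed
    qed
    moreover have "real i0 - \<eta> * real n \<le> real n"
    proof -
      have "q * real n \<le> 1 * real n" using q by (intro mult_right_mono) auto
      then show ?thesis using i0 \<zeta>n by linarith
    qed
    ultimately have "u n \<le> f n" by simp
    also have "f n = a - \<epsilon> / 4" using nn by (simp add: f_def)
    finally show False using un \<zeta> \<epsilon> by linarith
  qed
  then show "\<exists>\<zeta>>0. \<exists>N. \<forall>n\<ge>N. \<forall>i. a - \<zeta> \<le> u n \<longrightarrow> \<bar>real i - q * real n\<bar> \<le> \<zeta> * real n \<longrightarrow> a - \<epsilon> \<le> u i"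
    using \<zeta>(1) by blast
qed

text \<open>With dust, jumps smaller than \<open>\<eta> * n\<close> contribute little by the Lipschitz bound on \<open>u\<close>, and the
  remaining ones have bounded total rate; if \<open>u\<close> were below its limit superior near \<open>(1 - p) * n\<close>,
  harmonicity at \<open>n\<close> would push \<open>u n\<close> below it as well.\<close>

lemma propagates_dust:
  assumes sm: "summable (mixed_moment 0)" and p: "in_support p" "0 < p" "p < 1"
  shows "propagates (1 - p)"
  unfolding propagates_def
proof (intro allI impI)
  fix \<epsilon> :: real assume \<epsilon>: "0 < \<epsilon>"
  define q where "q = 1 - p"
  have q: "0 < q" "q < 1" using p by (auto simp: q_def)
  define e where "e = min (min (q / 8) (p / 16)) (\<epsilon> * q / (20 * real J))"
  have e: "0 < e" "e \<le> q / 8" "e \<le> p / 16" "e \<le> \<epsilon> * q / (20 * real J)"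
    using q p \<epsilon> J_pos by (auto simp: e_def)
  define c where "c = measure \<Lambda> {p - e<..<p + e} / 2"
  have c: "0 < c" using p e unfolding c_def in_support_def by simp
  define \<kappa> where "\<kappa> = \<epsilon> * c / (64 * real J)"
  have \<kappa>: "0 < \<kappa>" using \<epsilon> c J_pos by (simp add: \<kappa>_def)
  obtain \<eta> where \<eta>: "0 < \<eta>" "\<eta> \<le> p / 2" and near:
    "\<And>x I. 1 \<le> \<eta> * real x \<Longrightarrow> I \<subseteq> {..<x} \<Longrightarrow> (\<And>i. i \<in> I \<Longrightarrow> real x - real i \<le> \<eta> * real x) \<Longrightarrow>
       (\<Sum>i\<in>I. jump_rate x i * (real x - real i)) \<le> (real x + 1) * \<kappa>"
    using near_drift_small[OF sm \<kappa>, of "p / 2"] p by auto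
  define \<zeta> where "\<zeta> = min (min e (\<epsilon> / 8)) (\<epsilon> * c * \<eta>\<^sup>2 / (32 * mass))"
  have \<zeta>: "0 < \<zeta>" "\<zeta> \<le> e" "\<zeta> \<le> \<epsilon> / 8" "\<zeta> \<le> \<epsilon> * c * \<eta>\<^sup>2 / (32 * mass)"
    using e \<epsilon> c \<eta> mass_pos by (auto simp: \<zeta>_def)
  obtain N1 where N1: "\<And>x. N1 \<le> x \<Longrightarrow> u x \<le> a + \<zeta>" using eventually_le[OF \<zeta>(1)] by blast
  have \<kappa>': "0 < \<epsilon> * c / 16" using \<epsilon> c by simp
  obtain N2 where N2: "\<And>n. N2 \<le> n \<Longrightarrow> (\<Sum>i<N1. jump_rate n i) < \<epsilon> * c / 16"
    using sum_jump_rate_low_small[OF \<kappa>', of N1] by blast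
  obtain N where N: "max (max (max 1 (real J)) (max (real N2) (real N1))) (max (max (1 / e) (1 / e\<^sup>2)) (1 / \<eta>)) \<le> real N"
    using real_arch_simple by blast
  have "a - \<epsilon> \<le> u i0"
    if n: "N \<le> n" and un: "a - \<zeta> \<le> u n" and i0: "\<bar>real i0 - q * real n\<bar> \<le> \<zeta> * real n" for n i0
  proof (rule ccontr)
    assume "\<not> a - \<epsilon> \<le> u i0"
    then have ui0: "u i0 < a - \<epsilon>" by simp
    have nn0: "1 \<le> real n" "J \<le> n" "N2 \<le> n" "N1 \<le> n" "1 / e \<le> real n" "1 / e\<^sup>2 \<le> real n" "1 / \<eta> \<le> real n"
      using order_trans[OF N of_nat_mono[OF n]] by auto
    then have nn: "1 \<le> e * real n" "1 \<le> e\<^sup>2 * real n" "1 \<le> \<eta> * real n"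
      using e \<eta> by (auto simp: divide_le_eq mult_ac)
    have n0: "0 < n" using nn0 by simp
    define A where "A = {i. i < n \<and> real n - real i \<le> \<eta> * real n}"
    define F where "F = {i. i < n \<and> \<eta> * real n < real n - real i}"
    define Win where "Win = {i. i < n \<and> \<bar>real i - (1 - p) * real n\<bar> \<le> 4 * e * real n}"
    have fin: "finite A" "finite F" "finite Win" by (auto simp: A_def F_def Win_def)
    have WinF: "Win \<subseteq> F"
    proof
      fix i assume "i \<in> Win"
      then have i: "i < n" "real i \<le> (1 - p) * real n + 4 * e * real n" by (auto simp: Win_def)
      have "((1 - p) + 4 * e + \<eta>) * real n < 1 * real n"
        using e \<eta> p nn0 by (intro mult_strict_right_mono) auto
      then have "\<eta> * real n < real n - real i" using i by (simp add: algebra_simps)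
      then show "i \<in> F" using i by (simp add: F_def)
    qed
    have uWin: "u i \<le> a - \<epsilon> / 2" if "i \<in> Win" for i
    proof -
      have en: "\<zeta> * real n \<le> e * real n" "e * real n \<le> q / 8 * real n"
        using mult_right_mono[OF \<zeta>(2), of "real n"] mult_right_mono[OF e(2), of "real n"] by simp_all
      have iw: "\<bar>real i - q * real n\<bar> \<le> 4 * (e * real n)" using that by (simp add: Win_def q_def)
      have "\<bar>u i - u i0\<bar> \<le> real J * (5 * (e * real n)) / (q * real n / 2)"
        using iw i0 en q nn0 by (intro u_diff_le; (simp; fail | linarith))
      also have "\<dots> = real J * (10 / q) * e" using nn0 q by (simp add: field_simps)
      also have "\<dots> \<le> real J * (10 / q) * (\<epsilon> * q / (20 * real J))" using q e by (intro mult_left_mono) auto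
      also have "\<dots> = \<epsilon> / 2" using q J_pos by (simp add: field_simps)
      finally show ?thesis using ui0 by linarith
    qed
    have "(\<Sum>i\<in>A. jump_rate n i * (u i - u n)) \<le> (\<Sum>i\<in>A. jump_rate n i * (2 * real J / real n * (real n - real i)))"
    proof (intro sum_mono mult_left_mono jump_rate_nonneg)
      fix i assume "i \<in> A"
      then have i: "i < n" "real n - real i \<le> \<eta> * real n" by (auto simp: A_def)
      have "\<eta> * real n \<le> 1 / 2 * real n" using \<eta> p by (intro mult_right_mono) auto
      then have "real n / 2 \<le> real i + 1" using i by linarith
      then have "\<bar>u i - u n\<bar> \<le> real J * (real n - real i) / (real n / 2)"
        using i nn0 by (intro u_diff_le) auto
      then show "u i - u n \<le> 2 * real J / real n * (real n - real i)" by (simp add: field_simps)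
    qed
    also have "\<dots> = 2 * real J / real n * (\<Sum>i\<in>A. jump_rate n i * (real n - real i))"
      by (simp add: sum_distrib_left mult_ac)
    also have "\<dots> \<le> 2 * real J / real n * ((real n + 1) * \<kappa>)"
      using nn by (intro mult_left_mono near) (auto simp: A_def)
    also have "\<dots> \<le> 2 * real J / real n * ((2 * real n) * \<kappa>)"
      using nn0 \<kappa> by (intro mult_left_mono mult_right_mono) auto
    also have "\<dots> = \<epsilon> * c / 16" using nn0 J_pos by (simp add: \<kappa>_def field_simps)
    finally have sA: "(\<Sum>i\<in>A. jump_rate n i * (u i - u n)) \<le> \<epsilon> * c / 16" .
    have "0 = (\<Sum>i<n. jump_rate n i * (u n - u i))" using harm[OF nn0(2)] by (simp add: harmonic_at_def)
    also have "{..<n} = A \<union> F" by (auto simp: A_def F_def)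
    also have "(\<Sum>i\<in>A \<union> F. jump_rate n i * (u n - u i))
       = (\<Sum>i\<in>A. jump_rate n i * (u n - u i)) + (\<Sum>i\<in>F. jump_rate n i * (u n - u i))"
      using fin by (intro sum.union_disjoint) (auto simp: A_def F_def)
    also have "(\<Sum>i\<in>A. jump_rate n i * (u n - u i)) = - (\<Sum>i\<in>A. jump_rate n i * (u i - u n))"
      by (simp add: sum_negf[symmetric] algebra_simps)
    finally have sF: "(\<Sum>i\<in>F. jump_rate n i * (u n - u i)) \<le> \<epsilon> * c / 16" using sA by linarith
    have "(\<Sum>i\<in>F. (if i \<in> Win then \<epsilon> / 4 * jump_rate n i else 0) - 2 * \<zeta> * jump_rate n i
         - (if i \<in> {..<N1} then jump_rate n i else 0)) \<le> (\<Sum>i\<in>F. jump_rate n i * (u n - u i))"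
    proof (intro sum_mono)
      fix i assume "i \<in> F"
      have "(if i \<in> Win then \<epsilon> / 4 else 0) - 2 * \<zeta> - (if i \<in> {..<N1} then 1 else 0) \<le> u n - u i"
      proof -
        have W: "\<epsilon> / 4 \<le> u n - u i" if "i \<in> Win" using uWin[OF that] un \<zeta> \<epsilon> by linarith
        have L: "- 1 \<le> u n - u i" using u_nonneg[of n] u_le_1[of i] by linarith
        have U: "- 2 * \<zeta> \<le> u n - u i" if "N1 \<le> i" using N1[OF that] un by linarith
        show ?thesis using W L U \<zeta> by (cases "i \<in> Win"; cases "i < N1") auto
      qed
      from mult_left_mono[OF this jump_rate_nonneg[of n i]]
      show "(if i \<in> Win then \<epsilon> / 4 * jump_rate n i else 0) - 2 * \<zeta> * jump_rate n i
         - (if i \<in> {..<N1} then jump_rate n i else 0) \<le> jump_rate n i * (u n - u i)"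
        by (auto simp: algebra_simps split: if_splits)
    qed
    also have "(\<Sum>i\<in>F. (if i \<in> Win then \<epsilon> / 4 * jump_rate n i else 0) - 2 * \<zeta> * jump_rate n i
         - (if i \<in> {..<N1} then jump_rate n i else 0))
       = (\<Sum>i\<in>F. if i \<in> Win then \<epsilon> / 4 * jump_rate n i else 0) - 2 * \<zeta> * sum (jump_rate n) F
         - (\<Sum>i\<in>F. if i \<in> {..<N1} then jump_rate n i else 0)"
      by (simp add: sum_subtractf sum_distrib_left)
    finally have main: "(\<Sum>i\<in>F. if i \<in> Win then \<epsilon> / 4 * jump_rate n i else 0) - 2 * \<zeta> * sum (jump_rate n) F
         - (\<Sum>i\<in>F. if i \<in> {..<N1} then jump_rate n i else 0) \<le> \<epsilon> * c / 16" using sF by linarith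
    have "(\<Sum>i\<in>F. if i \<in> Win then \<epsilon> / 4 * jump_rate n i else 0) = (\<Sum>i\<in>Win. \<epsilon> / 4 * jump_rate n i)"
      using WinF fin by (intro sum.mono_neutral_cong_right) auto
    also have "\<dots> = \<epsilon> / 4 * sum (jump_rate n) Win" by (simp add: sum_distrib_left)
    also have "\<dots> \<ge> \<epsilon> / 4 * c"
      unfolding c_def Win_def using p e nn \<epsilon> by (intro mult_left_mono sum_jump_rate_window_ge) auto
    finally have t1: "\<epsilon> / 4 * c \<le> (\<Sum>i\<in>F. if i \<in> Win then \<epsilon> / 4 * jump_rate n i else 0)" .
    have "sum (jump_rate n) F \<le> mass / \<eta>\<^sup>2"
      using n0 \<eta> by (intro sum_jump_rate_far_le) (auto simp: F_def)
    then have "2 * \<zeta> * sum (jump_rate n) F \<le> 2 * (\<epsilon> * c * \<eta>\<^sup>2 / (32 * mass)) * (mass / \<eta>\<^sup>2)"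
      using \<zeta> \<epsilon> c mass_pos by (intro mult_mono) (auto intro!: sum_nonneg jump_rate_nonneg)
    also have "\<dots> = \<epsilon> * c / 16" using mass_pos \<eta> by (simp add: field_simps)
    finally have t2: "2 * \<zeta> * sum (jump_rate n) F \<le> \<epsilon> * c / 16" .
    have "(\<Sum>i\<in>F. if i \<in> {..<N1} then jump_rate n i else 0) \<le> (\<Sum>i<n. if i \<in> {..<N1} then jump_rate n i else 0)"
      by (intro sum_mono2) (auto simp: F_def jump_rate_nonneg)
    also have "\<dots> = (\<Sum>i<N1. jump_rate n i)"
      using nn0 by (intro sum.mono_neutral_cong_right) auto
    also have "\<dots> < \<epsilon> * c / 16" using N2 nn0 by simp
    finally have t3: "(\<Sum>i\<in>F. if i \<in> {..<N1} then jump_rate n i else 0) < \<epsilon> * c / 16" .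
    have "0 < \<epsilon> * c" using \<epsilon> c by simp
    then show False using main t1 t2 t3 by (simp add: field_simps)
  qed
  then show "\<exists>\<zeta>>0. \<exists>N. \<forall>n\<ge>N. \<forall>i. a - \<zeta> \<le> u n \<longrightarrow> \<bar>real i - (1 - p) * real n\<bar> \<le> \<zeta> * real n \<longrightarrow> a - \<epsilon> \<le> u i"
    using \<zeta>(1) unfolding q_def by blast
qed

lemma propagates_support:
  assumes "in_support p" "0 < p" "p < 1"
  shows "propagates (1 - p)"
  using propagates_dust propagates_no_dust assms by (cases "summable (mixed_moment 0)") auto

end

section \<open>Convergence of bounded harmonic functions\<close>

lemma ex_uniform_of_finite:
  assumes "\<And>k. k \<le> (r::nat) \<Longrightarrow> \<exists>\<zeta>>0. \<exists>N. P k (\<zeta>::real) (N::nat)"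
    and mono: "\<And>k \<zeta> N \<zeta>' N'. P k \<zeta> N \<Longrightarrow> \<zeta>' \<le> \<zeta> \<Longrightarrow> N \<le> N' \<Longrightarrow> P k \<zeta>' N'"
  shows "\<exists>\<zeta>>0. \<exists>N. \<forall>k\<le>r. P k \<zeta> N"
  using assms(1)
proof (induction r)
  case 0
  then show ?case by simp
next
  case (Suc r)
  then obtain \<zeta> N where 1: "0 < \<zeta>" "\<forall>k\<le>r. P k \<zeta> N" by (meson le_SucI)
  obtain \<zeta>' N' where 2: "0 < \<zeta>'" "P (Suc r) \<zeta>' N'" using Suc.prems[of "Suc r"] by auto
  have "P k (min \<zeta> \<zeta>') (max N N')" if "k \<le> Suc r" for k
    using that 1 2 mono[of k \<zeta> N "min \<zeta> \<zeta>'" "max N N'"] mono[of k \<zeta>' N' "min \<zeta> \<zeta>'" "max N N'"]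
    by (cases "k = Suc r") auto
  then show ?case using 1 2 by (intro exI[of _ "min \<zeta> \<zeta>'"] conjI exI[of _ "max N N'"]) auto
qed

context eventually_harmonic
begin

lemma propagating_exponents_dense:
  assumes "log_nonlattice \<Lambda>" "0 < \<eta>"
  obtains s0 where "0 \<le> s0" "\<And>x. s0 \<le> x \<Longrightarrow> \<exists>s. propagates (exp (- s)) \<and> x \<le> s \<and> s \<le> x + \<eta>"
proof -
  define S where "S = {s. 0 < s \<and> propagates (exp (- s))}"
  have add: "s + t \<in> S" if "s \<in> S" "t \<in> S" for s t
    using that propagates_mult[of "exp (- s)" "exp (- t)"] by (auto simp: S_def exp_add[symmetric])
  have nl: "\<not> S \<subseteq> range (\<lambda>z. real (Suc z) * d)" if d: "0 < d" for d
  proof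
    assume sub: "S \<subseteq> range (\<lambda>z. real (Suc z) * d)"
    define A where "A z = {1 - exp (- (real (Suc z) * d))}" for z
    have As: "range A \<subseteq> sets \<Lambda>" by (auto simp: A_def sets_eq_borel)
    have "AE p in \<Lambda>. p \<in> {0<..1} \<longrightarrow> p \<in> (\<Union>z. A z)"
      using AE_in_support AE_range
    proof eventually_elim
      case (elim p)
      show ?case
      proof
        assume "p \<in> {0<..1}"
        then have p: "0 < p" "p < 1" using elim by auto
        have "exp (- (- ln (1 - p))) = 1 - p" using p by simp
        moreover have "0 < - ln (1 - p)" using p by simp
        ultimately have "- ln (1 - p) \<in> S" using propagates_support[OF elim(1) p] by (simp add: S_def)
        then obtain z where z: "- ln (1 - p) = real (Suc z) * d" using sub by blast
        have "p = 1 - exp (ln (1 - p))" using p by simp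
        also have "ln (1 - p) = - (real (Suc z) * d)" using z by simp
        finally show "p \<in> (\<Union>z. A z)" unfolding A_def by blast
      qed
    qed
    then have "emeasure \<Lambda> {0<..1} \<le> emeasure \<Lambda> (\<Union>z. A z)"
      by (intro emeasure_mono_AE sets.countable_UN As)
    also have "\<dots> \<le> (\<Sum>z. emeasure \<Lambda> (A z))"
      by (intro emeasure_subadditive_countably As)
    also have "\<dots> < emeasure \<Lambda> {0<..1}" using assms(1) d unfolding log_nonlattice_def A_def by blast
    finally show False by simp
  qed
  obtain s0 where "0 \<le> s0" "\<And>x. s0 \<le> x \<Longrightarrow> \<exists>s\<in>S. x \<le> s \<and> s \<le> x + \<eta>"
    using additive_semigroup_asymptotically_dense[of S \<eta>, OF _ add nl assms(2)] by (auto simp: S_def)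
  then show ?thesis using that unfolding S_def by blast
qed

lemma window_near_limsup:
  assumes nl: "log_nonlattice \<Lambda>" and freq: "\<And>\<zeta> N. 0 < \<zeta> \<Longrightarrow> \<exists>n\<ge>N. a - \<zeta> \<le> u n"
    and \<epsilon>: "0 < \<epsilon>" and \<delta>: "0 < \<delta>" "\<delta> \<le> 1"
  shows "\<exists>K\<ge>K0. \<forall>i. \<delta> * real K \<le> real i \<longrightarrow> i < K \<longrightarrow> a - \<epsilon> \<le> u i"
proof -
  define \<nu> where "\<nu> = min 1 (\<epsilon> / (8 * real J))"
  have \<nu>: "0 < \<nu>" "\<nu> \<le> 1" "\<nu> \<le> \<epsilon> / (8 * real J)" using \<epsilon> J_pos by (auto simp: \<nu>_def)
  define \<eta> where "\<eta> = ln (1 + \<nu>)"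
  have \<eta>: "0 < \<eta>" "exp \<eta> = 1 + \<nu>" using \<nu> by (auto simp: \<eta>_def)
  obtain s0 where s0: "0 \<le> s0" "\<And>x. s0 \<le> x \<Longrightarrow> \<exists>s. propagates (exp (- s)) \<and> x \<le> s \<and> s \<le> x + \<eta>"
    using propagating_exponents_dense[OF nl \<eta>(1)] by blast
  have "\<forall>k. \<exists>s. propagates (exp (- s)) \<and> s0 + real k * \<eta> \<le> s \<and> s \<le> s0 + real k * \<eta> + \<eta>"
    using s0(2) \<eta> by simp
  then obtain S where S: "\<And>k. propagates (exp (- S k))" "\<And>k. s0 + real k * \<eta> \<le> S k"
    "\<And>k. S k \<le> s0 + real k * \<eta> + \<eta>" by metis
  obtain r where r: "ln (2 / \<delta>) / \<eta> \<le> real r" using real_arch_simple by blast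
  define P where "P k \<zeta> N \<longleftrightarrow> (\<forall>n\<ge>N. \<forall>i. a - \<zeta> \<le> u n \<longrightarrow>
     \<bar>real i - exp (- S k) * real n\<bar> \<le> \<zeta> * real n \<longrightarrow> a - \<epsilon> / 2 \<le> u i)" for k :: nat and \<zeta> N
  have "\<exists>\<zeta>>0. \<exists>N. \<forall>k\<le>r. P k \<zeta> N"
  proof (rule ex_uniform_of_finite)
    show "\<exists>\<zeta>>0. \<exists>N. P k \<zeta> N" for k
      using S(1)[of k] \<epsilon> unfolding propagates_def P_def by (meson half_gt_zero)
    show "P k \<zeta>' N'" if P: "P k \<zeta> N" and le: "\<zeta>' \<le> \<zeta>" "N \<le> N'" for k \<zeta> N \<zeta>' N'
      unfolding P_def
    proof (intro allI impI)
      fix n i assume *: "N' \<le> n" "a - \<zeta>' \<le> u n" "\<bar>real i - exp (- S k) * real n\<bar> \<le> \<zeta>' * real n"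
      have "\<zeta>' * real n \<le> \<zeta> * real n" using le by (intro mult_right_mono) auto
      then show "a - \<epsilon> / 2 \<le> u i" using P * le unfolding P_def
        by (meson diff_left_mono order_trans)
    qed
  qed
  then obtain \<zeta> N where \<zeta>: "0 < \<zeta>" and PN: "\<And>k. k \<le> r \<Longrightarrow> P k \<zeta> N" by blast
  define E where "E = exp (- s0)"
  have E: "0 < E" by (simp add: E_def)
  obtain N' where N': "max (max (real N) (1 / \<zeta>)) (max (max ((real K0 + 1) / E) (2 / E)) (16 * real J / (\<epsilon> * \<delta> * E))) \<le> real N'"
    using real_arch_simple by blast
  obtain n where n: "N' \<le> n" "a - \<zeta> \<le> u n" using freq[OF \<zeta>] by blast
  have nn0: "N \<le> n" "1 / \<zeta> \<le> real n" "(real K0 + 1) / E \<le> real n" "2 / E \<le> real n" "16 * real J / (\<epsilon> * \<delta> * E) \<le> real n"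
    using order_trans[OF N' of_nat_mono[OF n(1)]] by auto
  then have nn: "1 \<le> \<zeta> * real n" "real K0 + 1 \<le> E * real n" "2 \<le> E * real n" "16 * real J \<le> \<epsilon> * \<delta> * (E * real n)"
    using E \<zeta> \<epsilon> \<delta> by (auto simp: divide_le_eq mult_ac)
  have n0: "0 < real n" using nn by (cases n) auto
  define K where "K = nat \<lfloor>E * real n\<rfloor>"
  have "0 \<le> E * real n" using E by simp
  note K = floor_approx(2,3)[OF this, folded K_def]
  have "K0 \<le> K" using nn K by linarith
  moreover have "a - \<epsilon> \<le> u i" if i: "\<delta> * real K \<le> real i" "i < K" for i
  proof -
    have "\<delta> * (E * real n / 2) \<le> \<delta> * real K" using \<delta> K nn by (intro mult_left_mono) auto
    then have il: "\<delta> / 2 * E * real n \<le> real i" using i by simp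
    have pos: "0 < \<delta> / 2 * E * real n" using \<delta> E n0 by simp
    then have i0: "0 < real i" using il by linarith
    have iE: "real i \<le> E * real n" using i K by linarith
    define s where "s = ln (real n / real i)"
    have es: "exp s = real n / real i" using i0 n0 by (simp add: s_def)
    have "exp s0 \<le> real n / real i" using iE i0 by (simp add: E_def exp_minus field_simps)
    then have ss0: "s0 \<le> s" unfolding es[symmetric] by simp
    have "real n / real i \<le> real n / (\<delta> / 2 * E * real n)" using il pos n0 i0 by (intro divide_left_mono) auto
    also have "\<dots> = exp (s0 + ln (2 / \<delta>))" using \<delta> n0 by (simp add: E_def exp_add exp_minus field_simps)
    finally have ssr: "s \<le> s0 + ln (2 / \<delta>)" unfolding es[symmetric] by simp
    define k where "k = nat \<lfloor>(s - s0) / \<eta>\<rfloor>"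
    have "0 \<le> (s - s0) / \<eta>" using ss0 \<eta> by simp
    note k = floor_approx(2,3)[OF this, folded k_def]
    have "(s - s0) / \<eta> \<le> ln (2 / \<delta>) / \<eta>" using ssr \<eta> by (intro divide_right_mono) auto
    then have kr: "k \<le> r" using k r by linarith
    have k': "real k * \<eta> \<le> s - s0" "s - s0 \<le> (real k + 1) * \<eta>"
      using k \<eta> by (auto simp: le_divide_eq divide_le_eq)
    have sS: "s - S k \<le> \<eta>" "- \<eta> \<le> s - S k" using k' S(2,3)[of k] by (auto simp: ring_distribs)
    define \<theta> where "\<theta> = exp (- S k)"
    have \<theta>n: "\<theta> * real n = real i * exp (s - S k)" using es i0 by (simp add: \<theta>_def exp_diff exp_minus field_simps)
    have up: "\<theta> * real n \<le> real i * (1 + \<nu>)"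
      unfolding \<theta>n \<eta>(2)[symmetric] using sS by (intro mult_left_mono) auto
    have "exp (- \<eta>) = 1 / (1 + \<nu>)" by (simp add: exp_minus \<eta> field_simps)
    then have lo: "real i / (1 + \<nu>) \<le> \<theta> * real n"
      using mult_left_mono[of "exp (- \<eta>)" "exp (s - S k)" "real i"] sS unfolding \<theta>n by (metis exp_le_cancel_iff of_nat_0_le_iff times_divide_eq_right mult.right_neutral)
    have lo1: "real i - real i * \<nu> \<le> real i / (1 + \<nu>)"
    proof -
      have "(real i - real i * \<nu>) * (1 + \<nu>) = real i - real i * \<nu>\<^sup>2" by (simp add: algebra_simps power2_eq_square)
      then show ?thesis using \<nu> i0 by (subst pos_le_divide_eq) auto
    qed
    have lo2: "real i / 2 \<le> real i / (1 + \<nu>)" using \<nu> by (intro divide_left_mono) auto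
    define j where "j = nat \<lfloor>\<theta> * real n\<rfloor>"
    have "0 \<le> \<theta> * real n" by (simp add: \<theta>_def)
    note j = floor_approx[OF this, folded j_def]
    have uj: "a - \<epsilon> / 2 \<le> u j"
      using PN[OF kr] nn0(1) n(2) j(1) nn(1) unfolding P_def \<theta>_def by (meson order_trans)
    have jl: "real i / 2 \<le> real j + 1" using lo lo2 j(3) by linarith
    have "\<theta> * real n \<le> real i + real i * \<nu>" using up by (simp add: algebra_simps)
    then have ji: "\<bar>real j - real i\<bar> \<le> real i * \<nu> + 1" using lo lo1 j by linarith
    have "\<bar>u j - u i\<bar> \<le> real J * (real i * \<nu> + 1) / (real i / 2)"
      by (rule u_diff_le[OF _ jl _ ji]) (use i0 in auto)
    also have "\<dots> = 2 * real J * \<nu> + 2 * real J / real i" using i0 by (simp add: field_simps)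
    also have "2 * real J * \<nu> \<le> 2 * real J * (\<epsilon> / (8 * real J))" using \<nu> by (intro mult_left_mono) auto
    also have "\<dots> = \<epsilon> / 4" using J_pos by simp
    also have "2 * real J / real i \<le> \<epsilon> / 4"
    proof -
      have "8 * real J \<le> \<epsilon> * (\<delta> / 2 * E * real n)" using nn(4) by (simp add: mult_ac)
      also have "\<dots> \<le> \<epsilon> * real i" using il \<epsilon> by (intro mult_left_mono) auto
      finally show ?thesis using i0 by (simp add: field_simps)
    qed
    finally show ?thesis using uj by linarith
  qed
  ultimately show ?thesis by blast
qed

lemma converges_of_limsup:
  assumes nl: "log_nonlattice \<Lambda>" and freq: "\<And>\<zeta> N. 0 < \<zeta> \<Longrightarrow> \<exists>n\<ge>N. a - \<zeta> \<le> u n"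
  shows "u \<longlonglongrightarrow> a"
proof (rule LIMSEQ_I)
  fix e :: real assume e: "0 < e"
  define \<epsilon> where "\<epsilon> = e / 4"
  have \<epsilon>: "0 < \<epsilon>" using e by (simp add: \<epsilon>_def)
  have a1: "a \<le> 1"
  proof (rule field_le_epsilon)
    fix z :: real assume "0 < z"
    then obtain n where "a - z \<le> u n" using freq by blast
    then show "a \<le> 1 + z" using u_le_1[of n] by linarith
  qed
  have pos: "0 < \<epsilon> * mass / 48" using \<epsilon> mass_pos by simp
  obtain \<delta>0 where \<delta>0: "0 < \<delta>0" "\<delta>0 \<le> 1" "\<And>\<delta>'. 0 \<le> \<delta>' \<Longrightarrow> \<delta>' \<le> \<delta>0 \<Longrightarrow> log_moment \<delta>' < \<epsilon> * mass / 48"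
    using log_moment_small[OF pos] by blast
  define \<delta> where "\<delta> = \<delta>0 / 4"
  have \<delta>: "0 < \<delta>" "\<delta> \<le> 1" using \<delta>0 by (auto simp: \<delta>_def)
  obtain K0 where K0: "max (real J) (1 / \<delta>) \<le> real K0" using real_arch_simple by blast
  obtain K where K: "K0 \<le> K" "\<And>i. \<delta> * real K \<le> real i \<Longrightarrow> i < K \<Longrightarrow> a - \<epsilon> \<le> u i"
    using window_near_limsup[OF nl freq \<epsilon> \<delta>, of K0] by blast
  have KK: "J \<le> K" "1 / \<delta> \<le> real K" using order_trans[OF K0 of_nat_mono[OF K(1)]] by auto
  then have K1: "1 \<le> \<delta> * real K" using \<delta> by (simp add: divide_le_eq mult_ac)
  define m where "m = nat \<lceil>\<delta> * real K\<rceil>"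
  have "real m = of_int \<lceil>\<delta> * real K\<rceil>" unfolding m_def using K1 by simp
  then have m: "\<delta> * real K \<le> real m" "real m \<le> \<delta> * real K + 1" by linarith+
  have mK: "real m \<le> \<delta>0 / 2 * real K" using m K1 by (simp add: \<delta>_def)
  also have "\<dots> \<le> 1 / 2 * real K" using \<delta>0 by (intro mult_right_mono) auto
  finally have m2: "2 * m \<le> K" by linarith
  have K_pos: "1 \<le> K" using KK J_pos by simp
  have lower: "a - 2 * \<epsilon> \<le> u x" if x: "K \<le> x" for x
  proof -
    have "a - \<epsilon> - u x \<le> 48 / mass * log_moment (real m / real K)"
    proof (rule undershoot_bound[where h = "\<lambda>x. a - \<epsilon> - u x"])
      show "harmonic_at (\<lambda>x. a - \<epsilon> - u x) y" if "K \<le> y" for y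
      proof -
        have "(\<Sum>i<y. jump_rate y i * ((a - \<epsilon> - u y) - (a - \<epsilon> - u i))) = - (\<Sum>i<y. jump_rate y i * (u y - u i))"
          unfolding sum_negf[symmetric] by (intro sum.cong) (auto simp: algebra_simps)
        then show ?thesis using harm[of y] that KK by (simp add: harmonic_at_def)
      qed
      show "a - \<epsilon> - u i \<le> 1" for i using a1 \<epsilon> u_nonneg[of i] by linarith
      show "a - \<epsilon> - u i \<le> 0" if "m \<le> i" "i < K" for i
        using K(2)[of i] that m by linarith
    qed (use K_pos m2 x in auto)
    also have "\<dots> \<le> 48 / mass * (\<epsilon> * mass / 48)"
    proof (intro mult_left_mono less_imp_le[OF \<delta>0(3)])
      have "real m \<le> \<delta>0 * real K" using mK \<delta>0 mult_nonneg_nonneg[of \<delta>0 "real K"] by simp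
      then show "real m / real K \<le> \<delta>0" using K_pos by (simp add: divide_le_eq)
    qed (use mass_pos in auto)
    also have "\<dots> = \<epsilon>" using mass_pos by simp
    finally show ?thesis by simp
  qed
  obtain N where N: "\<And>x. N \<le> x \<Longrightarrow> u x \<le> a + \<epsilon>" using eventually_le[OF \<epsilon>] by blast
  show "\<exists>no. \<forall>n\<ge>no. norm (u n - a) < e"
  proof (intro exI[of _ "max K N"] allI impI)
    fix n assume "max K N \<le> n"
    then have "a - 2 * \<epsilon> \<le> u n" "u n \<le> a + \<epsilon>" using lower N by auto
    then show "norm (u n - a) < e" using e by (simp add: \<epsilon>_def)
  qed
qed

end

context log_integrable_measure
begin

theorem eventually_harmonic_convergent:
  assumes nl: "log_nonlattice \<Lambda>" and harm: "\<And>x. J \<le> x \<Longrightarrow> harmonic_at u x" and J: "1 \<le> J"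
    and u01: "\<And>x. 0 \<le> u x" "\<And>x. u x \<le> 1"
  shows "convergent u"
proof -
  define s where "s N = (SUP x\<in>{N..}. u x)" for N
  have bdd: "bdd_above (u ` {N..})" for N using u01 by (intro bdd_aboveI[of _ 1]) auto
  have s0: "0 \<le> s N" for N unfolding s_def using u01 bdd by (intro cSUP_upper2[of _ _ N]) auto
  have bs: "bdd_below (range s)" using s0 by (intro bdd_belowI[of _ 0]) auto
  define a where "a = (INF N. s N)"
  interpret eventually_harmonic \<Lambda> u J a
  proof unfold_locales
    fix \<epsilon> :: real assume "0 < \<epsilon>"
    then have "a < a + \<epsilon>" by simp
    then obtain N where "s N < a + \<epsilon>"
      using cINF_less_iff[OF UNIV_not_empty bs, of "a + \<epsilon>"] unfolding a_def by blast
    moreover have "u x \<le> s N" if "N \<le> x" for x unfolding s_def using that bdd by (intro cSUP_upper) auto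
    ultimately show "\<exists>N. \<forall>x\<ge>N. u x \<le> a + \<epsilon>" by (meson le_less_trans less_imp_le)
  qed (use harm J u01 in auto)
  have "\<exists>n\<ge>N. a - \<zeta> \<le> u n" if "0 < \<zeta>" for \<zeta> N
  proof -
    have "a \<le> s N" unfolding a_def using bs by (intro cINF_lower) auto
    then have "a - \<zeta> < s N" using that by simp
    then show ?thesis unfolding s_def using less_cSUP_iff[OF _ bdd[of N], of "a - \<zeta>"] by force
  qed
  then have "u \<longlonglongrightarrow> a" using converges_of_limsup[OF nl] by blast
  then show ?thesis by (rule convergentI)
qed

end

section \<open>The law of the last merger\<close>

definition block_family :: "nat set set \<Rightarrow> bool" where
  "block_family \<pi> \<longleftrightarrow> finite \<pi> \<and> disjoint \<pi> \<and> {} \<notin> \<pi>"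

lemma Union_notin_rest:
  assumes "block_family \<pi>" "A \<subseteq> \<pi>" "A \<noteq> {}"
  shows "\<Union>A \<notin> \<pi> - A"
proof
  assume B: "\<Union>A \<in> \<pi> - A"
  obtain c where c: "c \<in> A" using assms by blast
  then have "c \<in> \<pi>" "\<Union>A \<in> \<pi>" "c \<noteq> \<Union>A" using B assms by auto
  then have "c \<inter> \<Union>A = {}" using assms(1) disjointD unfolding block_family_def by metis
  then have "c = {}" using c by blast
  then show False using \<open>c \<in> \<pi>\<close> assms(1) unfolding block_family_def by blast
qed

lemma card_merge_blocks:
  assumes "block_family \<pi>" "A \<subseteq> \<pi>" "2 \<le> card A"
  shows "card (merge_blocks \<pi> A) = card \<pi> - card A + 1"
proof -
  have fin: "finite \<pi>" "finite A" using assms finite_subset by (auto simp: block_family_def)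
  have "A \<noteq> {}" using assms by auto
  then show ?thesis
    unfolding merge_blocks_def using Union_notin_rest[OF assms(1,2)] fin assms
    by (simp add: card_Diff_subset)
qed

lemma block_family_merge_blocks:
  assumes "block_family \<pi>" "A \<subseteq> \<pi>" "2 \<le> card A"
  shows "block_family (merge_blocks \<pi> A)"
proof -
  have dis: "x \<inter> y = {}" if "x \<in> \<pi>" "y \<in> \<pi>" "x \<noteq> y" for x y
    using assms(1) that disjointD unfolding block_family_def by metis
  have d: "x \<inter> \<Union>A = {}" if "x \<in> \<pi> - A" for x
    using dis[of x] that assms(2) by blast
  have "disjoint (merge_blocks \<pi> A)"
  proof (rule disjointI)
    fix x y assume "x \<in> merge_blocks \<pi> A" "y \<in> merge_blocks \<pi> A" "x \<noteq> y"
    then consider "x \<in> \<pi> - A" "y \<in> \<pi> - A" | "x \<in> \<pi> - A" "y = \<Union>A" | "x = \<Union>A" "y \<in> \<pi> - A"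
      unfolding merge_blocks_def by blast
    then show "x \<inter> y = {}"
      using dis[of x y] d[of x] d[of y] \<open>x \<noteq> y\<close> by cases auto
  qed
  moreover have "{} \<notin> merge_blocks \<pi> A"
  proof -
    obtain c where c: "c \<in> A" using assms(3) by fastforce
    then have "c \<noteq> {}" using assms unfolding block_family_def by auto
    then have "\<Union>A \<noteq> {}" using c by auto
    then show ?thesis using assms(1) unfolding block_family_def merge_blocks_def by auto
  qed
  ultimately show ?thesis using assms(1) by (simp add: block_family_def merge_blocks_def)
qed

lemma sum_over_subsets_by_card:
  fixes \<phi> :: "nat \<Rightarrow> real"
  assumes "finite \<pi>"
  shows "(\<Sum>A | A \<subseteq> \<pi> \<and> 2 \<le> card A. \<phi> (card A)) = (\<Sum>k=2..card \<pi>. real (card \<pi> choose k) * \<phi> k)"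
proof -
  let ?S = "{A. A \<subseteq> \<pi> \<and> 2 \<le> card A}"
  have fin: "finite ?S" using assms by simp
  have "(\<Sum>A\<in>?S. \<phi> (card A)) = (\<Sum>k\<in>{2..card \<pi>}. \<Sum>A | A \<in> ?S \<and> card A = k. \<phi> (card A))"
    using assms by (intro sum.group[symmetric] fin) (auto intro: card_mono)
  also have "\<dots> = (\<Sum>k=2..card \<pi>. real (card \<pi> choose k) * \<phi> k)"
  proof (intro sum.cong refl)
    fix k assume k: "k \<in> {2..card \<pi>}"
    have "{A. A \<in> ?S \<and> card A = k} = {A. A \<subseteq> \<pi> \<and> card A = k}" using k by auto
    then show "(\<Sum>A | A \<in> ?S \<and> card A = k. \<phi> (card A)) = real (card \<pi> choose k) * \<phi> k"
      using n_subsets[OF assms, of k] by simp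
  qed
  finally show ?thesis .
qed

lemma block_family_singletons: "block_family (singletons n)"
  by (auto simp: block_family_def singletons_def disjoint_def)

lemma card_singletons: "card (singletons n) = n"
  unfolding singletons_def by (subst card_image) auto

context log_integrable_measure
begin

abbreviation total_jump_rate :: "nat \<Rightarrow> real" where
  "total_jump_rate x \<equiv> \<Sum>i<x. jump_rate x i"

lemma jump_rate_eq_lam_rate:
  assumes "i < x"
  shows "jump_rate x i = real (Suc x choose (Suc x - i)) * lam_rate \<Lambda> (Suc x) (Suc x - i)"
proof -
  have "Suc x - i - 2 = x - 1 - i" "Suc x - (Suc x - i) = i" using assms by auto
  then show ?thesis
    using binomial_symmetric[of i "Suc x"] assms
    by (simp add: jump_rate_eq mixed_moment_def lam_rate_def)
qed

lemma sum_lam_rate: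
  "(\<Sum>k=2..Suc x. real (Suc x choose k) * lam_rate \<Lambda> (Suc x) k * g k) = (\<Sum>i<x. jump_rate x i * g (Suc x - i))"
  by (rule sum.reindex_bij_witness[of _ "\<lambda>i. Suc x - i" "\<lambda>k. Suc x - k"])
     (auto simp: jump_rate_eq_lam_rate simp del: binomial_Suc_Suc)

lemma total_rate_eq: "total_rate \<Lambda> (Suc x) = total_jump_rate x"
  using sum_lam_rate[of x "\<lambda>_. 1"] by (simp add: total_rate_def)

lemma lam_rate_nonneg: "0 \<le> lam_rate \<Lambda> b k"
  using mixed_moment_nonneg by (simp add: lam_rate_def mixed_moment_def)

lemma pmf_bind_coal_step:
  assumes \<pi>: "block_family \<pi>" "card \<pi> = Suc x" and x: "0 < x"
  shows "pmf (bind_pmf (coal_step \<Lambda> \<pi>) F) j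
    = (\<Sum>A | A \<subseteq> \<pi> \<and> 2 \<le> card A. lam_rate \<Lambda> (Suc x) (card A) / total_jump_rate x * pmf (F (merge_blocks \<pi> A)) j)"
proof -
  let ?S = "{A. A \<subseteq> \<pi> \<and> 2 \<le> card A}"
  define c where "c A = lam_rate \<Lambda> (Suc x) (card A) / total_jump_rate x" for A :: "nat set set"
  define f where "f \<pi>' = (\<Sum>A\<in>{A \<in> ?S. merge_blocks \<pi> A = \<pi>'}. c A)" for \<pi>'
  have fin\<pi>: "finite \<pi>" using \<pi> by (simp add: block_family_def)
  then have fin: "finite ?S" by simp
  note T = sum_jump_rate_pos[OF x]
  have c0: "0 \<le> c A" for A unfolding c_def using lam_rate_nonneg T by (intro divide_nonneg_pos)
  have f0: "0 \<le> f \<pi>'" for \<pi>' unfolding f_def by (intro sum_nonneg c0)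
  have out: "f \<pi>' = 0" if "\<pi>' \<notin> merge_blocks \<pi> ` ?S" for \<pi>'
  proof -
    have "{A \<in> ?S. merge_blocks \<pi> A = \<pi>'} = {}" using that by blast
    then show ?thesis unfolding f_def by (simp only: sum.empty)
  qed
  have "(\<Sum>A\<in>?S. c A) = (\<Sum>k=2..Suc x. real (Suc x choose k) * (lam_rate \<Lambda> (Suc x) k / total_jump_rate x))"
    unfolding c_def using sum_over_subsets_by_card[OF fin\<pi>, of "\<lambda>k. lam_rate \<Lambda> (Suc x) k / total_jump_rate x"] \<pi>
    by simp
  also have "\<dots> = (\<Sum>k=2..Suc x. real (Suc x choose k) * lam_rate \<Lambda> (Suc x) k * (1 / total_jump_rate x))"
    by (intro sum.cong) auto
  also have "\<dots> = (\<Sum>i<x. jump_rate x i * (1 / total_jump_rate x))" by (rule sum_lam_rate)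
  also have "\<dots> = 1" using T by (simp flip: sum_divide_distrib)
  finally have c1: "(\<Sum>A\<in>?S. c A) = 1" .
  have f_sum: "(\<Sum>\<pi>'\<in>merge_blocks \<pi> ` ?S. f \<pi>' * g \<pi>') = (\<Sum>A\<in>?S. c A * g (merge_blocks \<pi> A))" for g
  proof -
    have "(\<Sum>A\<in>?S. c A * g (merge_blocks \<pi> A))
       = (\<Sum>\<pi>'\<in>merge_blocks \<pi> ` ?S. \<Sum>A\<in>{A \<in> ?S. merge_blocks \<pi> A = \<pi>'}. c A * g (merge_blocks \<pi> A))"
      by (rule sum.image_gen[OF fin])
    also have "\<dots> = (\<Sum>\<pi>'\<in>merge_blocks \<pi> ` ?S. f \<pi>' * g \<pi>')"
      unfolding f_def sum_distrib_right by (intro sum.cong refl) auto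
    finally show ?thesis by simp
  qed
  have step: "coal_step \<Lambda> \<pi> = embed_pmf f"
    unfolding coal_step_def f_def c_def \<pi>(2) total_rate_eq by (intro arg_cong[where f = embed_pmf] ext sum.cong) auto
  have "(\<integral>\<^sup>+\<pi>'. ennreal (f \<pi>') \<partial>count_space UNIV) = (\<Sum>\<pi>'\<in>merge_blocks \<pi> ` ?S. ennreal (f \<pi>'))"
    using fin out by (intro nn_integral_count_space') auto
  also have "\<dots> = ennreal (\<Sum>\<pi>'\<in>merge_blocks \<pi> ` ?S. f \<pi>')" using f0 by (intro sum_ennreal)
  also have "\<dots> = 1" using f_sum[of "\<lambda>_. 1"] c1 by simp
  finally have pmf_step: "pmf (coal_step \<Lambda> \<pi>) \<pi>' = f \<pi>'" for \<pi>'
    unfolding step using f0 by (intro pmf_embed_pmf) auto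
  have "pmf (bind_pmf (coal_step \<Lambda> \<pi>) F) j = (\<integral>\<pi>'. pmf (F \<pi>') j \<partial>measure_pmf (coal_step \<Lambda> \<pi>))"
    by (rule pmf_bind)
  also have "\<dots> = (\<Sum>\<pi>'\<in>merge_blocks \<pi> ` ?S. pmf (coal_step \<Lambda> \<pi>) \<pi>' *\<^sub>R pmf (F \<pi>') j)"
  proof (rule integral_measure_pmf)
    fix \<pi>' assume "\<pi>' \<in> set_pmf (coal_step \<Lambda> \<pi>)"
    then have "f \<pi>' \<noteq> 0" using pmf_step by (simp add: set_pmf_iff)
    then show "\<pi>' \<in> merge_blocks \<pi> ` ?S" using out by blast
  qed (use fin in auto)
  also have "\<dots> = (\<Sum>A\<in>?S. c A * pmf (F (merge_blocks \<pi> A)) j)"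
    unfolding pmf_step real_scaleR_def by (rule f_sum)
  finally show ?thesis unfolding c_def .
qed

function last_prob :: "nat \<Rightarrow> nat \<Rightarrow> real" where
  "last_prob j x = (if x = 0 then (if j = 1 then 1 else 0) else
     (\<Sum>i<x. jump_rate x i * (if i = 0 then (if j = Suc x then 1 else 0) else last_prob j i)) / total_jump_rate x)"
  by auto
termination by (relation "Wellfounded.measure snd") auto

declare last_prob.simps [simp del]

lemma last_prob_0: "last_prob j 0 = (if j = 1 then 1 else 0)"
  by (simp add: last_prob.simps)

lemma last_prob_rec:
  assumes "0 < x"
  shows "total_jump_rate x * last_prob j x
    = (\<Sum>i<x. jump_rate x i * (if i = 0 then (if j = Suc x then 1 else 0) else last_prob j i))"
  using assms sum_jump_rate_pos[OF assms] by (subst last_prob.simps) simp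

lemma pmf_last_blocks:
  assumes "block_family \<pi>" "card \<pi> = Suc x" "Suc x \<le> m"
  shows "pmf (last_blocks \<Lambda> m \<pi>) j = last_prob j x"
  using assms
proof (induction x arbitrary: \<pi> m rule: less_induct)
  case (less x)
  obtain m' where m: "m = Suc m'" "x \<le> m'" using less.prems by (cases m) auto
  show ?case
  proof (cases "x = 0")
    case True
    then show ?thesis using m less.prems by (simp add: last_prob_0 pmf_return)
  next
    case False
    then have x: "0 < x" by simp
    define g where "g k = (if Suc x - k = 0 then (if j = Suc x then 1 else 0) else last_prob j (Suc x - k))" for k
    define F where "F \<pi>' = (if card \<pi>' = 1 then return_pmf (card \<pi>) else last_blocks \<Lambda> m' \<pi>')" for \<pi>'
    have fin: "finite \<pi>" using less.prems by (simp add: block_family_def)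
    have "pmf (last_blocks \<Lambda> m \<pi>) j = pmf (bind_pmf (coal_step \<Lambda> \<pi>) F) j"
      using m x less.prems by (simp add: F_def[abs_def])
    also have "\<dots> = (\<Sum>A | A \<subseteq> \<pi> \<and> 2 \<le> card A. lam_rate \<Lambda> (Suc x) (card A) / total_jump_rate x * pmf (F (merge_blocks \<pi> A)) j)"
      using less.prems x by (intro pmf_bind_coal_step) auto
    also have "\<dots> = (\<Sum>A | A \<subseteq> \<pi> \<and> 2 \<le> card A. lam_rate \<Lambda> (Suc x) (card A) / total_jump_rate x * g (card A))"
    proof (intro sum.cong refl arg_cong2[where f = "(*)"])
      fix A assume "A \<in> {A. A \<subseteq> \<pi> \<and> 2 \<le> card A}"
      then have A: "A \<subseteq> \<pi>" "2 \<le> card A" by auto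
      have cA: "card A \<le> Suc x" using card_mono[OF fin A(1)] less.prems by simp
      have cm: "card (merge_blocks \<pi> A) = Suc (Suc x - card A)"
        using card_merge_blocks[OF less.prems(1) A] less.prems by simp
      show "pmf (F (merge_blocks \<pi> A)) j = g (card A)"
      proof (cases "Suc x - card A = 0")
        case True
        then show ?thesis using cm less.prems by (simp add: F_def g_def pmf_return)
      next
        case False
        have "pmf (last_blocks \<Lambda> m' (merge_blocks \<pi> A)) j = last_prob j (Suc x - card A)"
          using A x m by (intro less.IH block_family_merge_blocks less.prems cm) auto
        then show ?thesis using False cm by (simp add: F_def g_def)
      qed
    qed
    also have "\<dots> = (\<Sum>k=2..Suc x. real (Suc x choose k) * (lam_rate \<Lambda> (Suc x) k / total_jump_rate x * g k))"
      using sum_over_subsets_by_card[OF fin, of "\<lambda>k. lam_rate \<Lambda> (Suc x) k / total_jump_rate x * g k"] less.prems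
      by simp
    also have "\<dots> = (\<Sum>k=2..Suc x. real (Suc x choose k) * lam_rate \<Lambda> (Suc x) k * g k) / total_jump_rate x"
      unfolding sum_divide_distrib by (intro sum.cong) auto
    also have "\<dots> = (\<Sum>i<x. jump_rate x i * g (Suc x - i)) / total_jump_rate x"
      by (simp only: sum_lam_rate)
    also have "(\<Sum>i<x. jump_rate x i * g (Suc x - i)) = total_jump_rate x * last_prob j x"
      unfolding last_prob_rec[OF x] g_def by (intro sum.cong refl) auto
    finally show ?thesis using sum_jump_rate_pos[OF x] by simp
  qed
qed

lemma pmf_L_law: "pmf (L_law \<Lambda> (Suc x)) j = last_prob j x"
  unfolding L_law_def
  by (rule pmf_last_blocks) (auto simp: block_family_singletons card_singletons)

lemma last_prob_nonneg: "0 \<le> last_prob j x"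
  using pmf_nonneg[of "L_law \<Lambda> (Suc x)" j] unfolding pmf_L_law .

lemma last_prob_le_1: "last_prob j x \<le> 1"
  using pmf_le_1[of "L_law \<Lambda> (Suc x)" j] unfolding pmf_L_law .

lemma sum_last_prob_le_1: "(\<Sum>j\<le>K. last_prob j x) \<le> 1"
  unfolding pmf_L_law[symmetric] measure_measure_pmf_finite[OF finite_atMost, symmetric] by simp

lemma last_prob_convergent:
  assumes "log_nonlattice \<Lambda>"
  shows "convergent (last_prob j)"
proof -
  define u where "u x = (if x = 0 then 0 else last_prob j x)" for x
  have "convergent u"
  proof (rule eventually_harmonic_convergent[OF assms, of "max 1 j"])
    fix x assume x: "max 1 j \<le> x"
    then have x0: "0 < x" "j \<noteq> Suc x" by auto
    have "total_jump_rate x * u x = (\<Sum>i<x. jump_rate x i * u i)"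
      using last_prob_rec[OF x0(1), of j] x0 by (auto simp: u_def intro!: sum.cong)
    then show "harmonic_at u x" by (simp add: harmonic_at_iff)
  qed (auto simp: u_def last_prob_nonneg last_prob_le_1)
  then have "convergent (\<lambda>x. u (Suc x))" by (simp add: convergent_Suc_iff)
  then show ?thesis unfolding u_def by (simp add: convergent_Suc_iff)
qed

lemma sum_last_prob_eq_1:
  assumes "x < K"
  shows "(\<Sum>j\<le>K. last_prob j x) = 1"
  using assms
proof (induction x rule: less_induct)
  case (less x)
  show ?case
  proof (cases "x = 0")
    case True
    then show ?thesis using less.prems by (simp add: last_prob_0)
  next
    case False
    then have x: "0 < x" by simp
    have "total_jump_rate x * (\<Sum>j\<le>K. last_prob j x)
       = (\<Sum>j\<le>K. \<Sum>i<x. jump_rate x i * (if i = 0 then (if j = Suc x then 1 else 0) else last_prob j i))"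
      unfolding sum_distrib_left last_prob_rec[OF x] ..
    also have "\<dots> = (\<Sum>i<x. jump_rate x i * (\<Sum>j\<le>K. if i = 0 then (if j = Suc x then 1 else 0) else last_prob j i))"
      unfolding sum_distrib_left by (rule sum.swap)
    also have "\<dots> = (\<Sum>i<x. jump_rate x i)"
    proof (intro sum.cong refl)
      fix i assume i: "i \<in> {..<x}"
      show "jump_rate x i * (\<Sum>j\<le>K. if i = 0 then (if j = Suc x then 1 else 0) else last_prob j i) = jump_rate x i"
        using less i by (cases "i = 0") auto
    qed
    finally show ?thesis using sum_jump_rate_pos[OF x] by simp
  qed
qed

lemma last_prob_tail_le:
  assumes K: "2 \<le> K"
  shows "1 - (\<Sum>j\<le>K. last_prob j x) \<le> 48 / mass * log_moment (1 / real K)"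
proof (cases "K \<le> x")
  case True
  define h where "h x = (if x = 0 then 1 else 1 - (\<Sum>j\<le>K. last_prob j x))" for x
  have "h x \<le> 48 / mass * log_moment (real 1 / real K)"
  proof (rule undershoot_bound)
    fix y assume y: "K \<le> y"
    then have y0: "0 < y" using K by simp
    have "total_jump_rate y * (\<Sum>j\<le>K. last_prob j y)
       = (\<Sum>j\<le>K. \<Sum>i<y. jump_rate y i * (if i = 0 then (if j = Suc y then 1 else 0) else last_prob j i))"
      unfolding sum_distrib_left last_prob_rec[OF y0] ..
    also have "\<dots> = (\<Sum>i<y. jump_rate y i * (\<Sum>j\<le>K. if i = 0 then (if j = Suc y then 1 else 0) else last_prob j i))"
      unfolding sum_distrib_left by (rule sum.swap)
    also have "\<dots> = (\<Sum>i<y. jump_rate y i * (1 - h i))"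
      using y by (intro sum.cong refl) (auto simp: h_def)
    also have "\<dots> = total_jump_rate y - (\<Sum>i<y. jump_rate y i * h i)"
      by (simp add: right_diff_distrib sum_subtractf)
    finally show "harmonic_at h y"
      using y0 by (simp add: harmonic_at_iff h_def[of y] right_diff_distrib)
  next
    show "h i \<le> 1" for i by (auto simp: h_def intro!: sum_nonneg last_prob_nonneg)
    show "h i \<le> 0" if "1 \<le> i" "i < K" for i using that sum_last_prob_eq_1[of i K] by (simp add: h_def)
  qed (use K True in auto)
  then show ?thesis using True K by (simp add: h_def)
next
  case False
  have "0 \<le> log_moment (1 / real K)"
    unfolding log_moment_def
  proof (rule integral_nonneg_AE)
    show "AE p in \<Lambda>. 0 \<le> ln (1 + 1 / real K / (1 - p))"
      using AE_range by eventually_elim (auto intro!: ln_ge_zero)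
  qed
  then show ?thesis using False sum_last_prob_eq_1[of x K] mass_pos by simp
qed

theorem L_law_limit:
  assumes "log_nonlattice \<Lambda>"
  obtains P where "\<And>j. (\<lambda>n. pmf (L_law \<Lambda> n) j) \<longlonglongrightarrow> pmf P j"
proof -
  define l where "l j = lim (last_prob j)" for j
  have lim: "last_prob j \<longlonglongrightarrow> l j" for j
    unfolding l_def using last_prob_convergent[OF assms] by (simp add: convergent_LIMSEQ_iff)
  have l0: "0 \<le> l j" for j
    using lim by (rule LIMSEQ_le_const) (auto simp: last_prob_nonneg)
  have sum_lim: "(\<lambda>x. \<Sum>j\<le>K. last_prob j x) \<longlonglongrightarrow> (\<Sum>j\<le>K. l j)" for K
    using lim by (intro tendsto_sum)
  have up: "(\<Sum>j\<le>K. l j) \<le> 1" for K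
    using sum_lim by (rule LIMSEQ_le_const2) (auto simp: sum_last_prob_le_1)
  have lo: "1 - 48 / mass * log_moment (1 / real K) \<le> (\<Sum>j\<le>K. l j)" if "2 \<le> K" for K
  proof (rule LIMSEQ_le_const[OF sum_lim])
    have "1 - 48 / mass * log_moment (1 / real K) \<le> (\<Sum>j\<le>K. last_prob j x)" for x
      using last_prob_tail_le[OF that, of x] by linarith
    then show "\<exists>N. \<forall>n\<ge>N. 1 - 48 / mass * log_moment (1 / real K) \<le> (\<Sum>j\<le>K. last_prob j n)" by blast
  qed
  have "(\<lambda>K. \<Sum>j\<le>K. l j) \<longlonglongrightarrow> 1"
  proof (rule LIMSEQ_I)
    fix e :: real assume e: "0 < e"
    then have "0 < e * mass / 48" using mass_pos by simp
    then obtain \<delta> where \<delta>: "0 < \<delta>" "\<And>\<delta>'. 0 \<le> \<delta>' \<Longrightarrow> \<delta>' \<le> \<delta> \<Longrightarrow> log_moment \<delta>' < e * mass / 48"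
      using log_moment_small by metis
    obtain N where N: "max 2 (1 / \<delta>) \<le> real N" using real_arch_simple by blast
    show "\<exists>no. \<forall>n\<ge>no. norm ((\<Sum>j\<le>n. l j) - 1) < e"
    proof (intro exI[of _ N] allI impI)
      fix n assume n: "N \<le> n"
      have n2: "2 \<le> n" "1 / \<delta> \<le> real n" using order_trans[OF N of_nat_mono[OF n]] by auto
      then have "1 / real n \<le> \<delta>" using \<delta> by (simp add: field_simps)
      then have "log_moment (1 / real n) < e * mass / 48" using \<delta>(2) by simp
      then have "48 / mass * log_moment (1 / real n) < 48 / mass * (e * mass / 48)"
        using mass_pos by (intro mult_strict_left_mono) auto
      then show "norm ((\<Sum>j\<le>n. l j) - 1) < e" using lo[OF n2(1)] up[of n] mass_pos by simp
    qed
  qed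
  then have "l sums 1" by (simp add: sums_def_le)
  then have "(\<integral>\<^sup>+j. ennreal (l j) \<partial>count_space UNIV) = 1"
    unfolding nn_integral_count_space_nat using l0 by (subst suminf_ennreal_eq[of l 1]) auto
  then have "pmf (embed_pmf l) j = l j" for j using l0 by (intro pmf_embed_pmf) auto
  then have "(\<lambda>n. pmf (L_law \<Lambda> (Suc n)) j) \<longlonglongrightarrow> pmf (embed_pmf l) j" for j
    using lim by (simp add: pmf_L_law)
  then have "(\<lambda>n. pmf (L_law \<Lambda> n) j) \<longlonglongrightarrow> pmf (embed_pmf l) j" for j by (rule LIMSEQ_imp_Suc)
  then show ?thesis by (rule that)
qed

end

lemma weak_conv_m_of_pmf_tendsto:
  fixes P :: "nat \<Rightarrow> nat pmf"
  assumes "\<And>j. (\<lambda>n. pmf (P n) j) \<longlonglongrightarrow> pmf Q j"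
  shows "weak_conv_m (\<lambda>n. distr (measure_pmf (P n)) borel real) (distr (measure_pmf Q) borel real)"
proof -
  have cdf_eq: "cdf (distr (measure_pmf R) borel real) x = (\<Sum>j | real j \<le> x. pmf R j)" for R :: "nat pmf" and x
  proof -
    have "finite {j. real j \<le> x}"
      by (rule finite_subset[of _ "{..nat \<lfloor>x\<rfloor>}"]) (auto simp: le_nat_floor)
    moreover have "real -` {..x} = {j. real j \<le> x}" by auto
    ultimately show ?thesis by (simp add: cdf_def measure_distr measure_measure_pmf_finite)
  qed
  show ?thesis
    unfolding weak_conv_m_def weak_conv_def cdf_eq using assms by (auto intro!: tendsto_sum)
qed

theorem theorem2:
  fixes \<Lambda> :: "real measure"
  assumes "sets \<Lambda> = sets borel"
    and "finite_measure \<Lambda>"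
    and "emeasure \<Lambda> (- {0..1}) = 0"
    and "emeasure \<Lambda> {0..1} \<noteq> 0"
    and "(\<integral>\<^sup>+p. (if p = 1 then \<infinity> else ennreal \<bar>ln (1 - p)\<bar>) \<partial>\<Lambda>) < \<infinity>"
    and "log_nonlattice \<Lambda>"
  shows "\<exists>M. real_distribution M \<and>
           weak_conv_m (\<lambda>n. distr (measure_pmf (L_law \<Lambda> n)) borel real) M"
proof -
  interpret finite_measure \<Lambda> by fact
  interpret log_integrable_measure \<Lambda> by unfold_locales (fact assms)+
  obtain P where P: "\<And>j. (\<lambda>n. pmf (L_law \<Lambda> n) j) \<longlonglongrightarrow> pmf P j"
    using L_law_limit[OF assms(6)] by blast
  have "real_distribution (distr (measure_pmf P) borel real)"
    by (intro prob_space.real_distribution_distr measure_pmf.prob_space_axioms) simp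
  then show ?thesis using weak_conv_m_of_pmf_tendsto[OF P] by blast
qed

end
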